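(* There exists no proper biharmonic hypersurface with constant mean curvature in a (4-dimensional) generalized complex space form $N(\alpha,\beta)$ of negative scalar curvature.
   Context: A generalized complex space form is an almost Hermitian manifold $(N,g,J)$ whose curvature tensor has the form $R=\alpha R_1+\beta R_2$, with $\alpha,\beta$ smooth functions on $N$ and $$R_1(X,Y)Z=g(Y,Z)X-g(X,Z)Y,$$ $$R_2(X,Y)Z=g(JY,Z)JX-g(JX,Z)JY+2g(JY,X)JZ.$$ $N(\alpha,\beta)$ denotes such a manifold of real dimension 4. Curvature convention: $R(X,Y)=[\nabla_X,\nabla_Y]-\nabla_{[X,Y]}$. It is known (Tricerri–Vanhecke) that $\alpha+\beta$ is constant; $N(\alpha,\beta)$ is Einstein with constant scalar curvature $12(\alpha+\beta)$. Constant mean curvature means that the length $|H|$ of the mean curvature vector field $H$ is constant. A submanifold given by an isometric immersion $\psi:M\to N$ is biharmonic if $\tau_2(\psi)=0$, where $\tau_2(\psi)=\Delta\tau(\psi)-\mathrm{tr}\big(R^N(d\psi,\tau(\psi))d\psi\big)$, $\tau(\psi)$ is the tension field and $\Delta V=\mathrm{tr}(\nabla^2V)$ is the rough Laplacian on sections of $\psi^{-1}(TN)$. It is proper biharmonic if it is biharmonic and not harmonic (i.e. not minimal). *)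

theory Defs
  imports "HOL-Analysis.Analysis"
begin

section \<open>Smooth maps between Euclidean spaces\<close>

text \<open>Intended for open sets: derivatives are taken in the ambient space.\<close>

primrec times_differentiable_on ::
  "nat \<Rightarrow> 'a::real_normed_vector set \<Rightarrow> ('a \<Rightarrow> 'b::real_normed_vector) \<Rightarrow> bool" where
  "times_differentiable_on 0 S f \<longleftrightarrow> continuous_on S f"
| "times_differentiable_on (Suc k) S f \<longleftrightarrow>
     (\<forall>x\<in>S. f differentiable (at x)) \<and>
     (\<forall>v. times_differentiable_on k S (\<lambda>x. frechet_derivative f (at x) v))"

definition smooth_on :: "'a::real_normed_vector set \<Rightarrow> ('a \<Rightarrow> 'b::real_normed_vector) \<Rightarrow> bool" where
  "smooth_on S f \<longleftrightarrow> (\<forall>k. times_differentiable_on k S f)"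

abbreviation dif :: "('a::real_normed_vector \<Rightarrow> 'b::real_normed_vector) \<Rightarrow> 'a \<Rightarrow> 'a \<Rightarrow> 'b" where
  "dif f x \<equiv> frechet_derivative f (at x)"

definition pd :: "'n::finite \<Rightarrow> (real^'n \<Rightarrow> 'b::real_normed_vector) \<Rightarrow> real^'n \<Rightarrow> 'b" where
  "pd i f x = dif f x (axis i 1)"


section \<open>Smooth manifolds\<close>

text \<open>The points of a manifold form a type in the classes \<^class>\<open>t2_space\<close> and
  \<^class>\<open>second_countable_topology\<close>. A chart is a pair of a domain and a coordinate map; the values
  of the map off the domain are irrelevant. The dimension is the size of the index type \<open>'n\<close>.\<close>

type_synonym ('p, 'n) chart = "'p set \<times> ('p \<Rightarrow> real^'n)"

abbreviation cdom :: "('p, 'n::finite) chart \<Rightarrow> 'p set" where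
  "cdom c \<equiv> fst c"

abbreviation cmap :: "('p, 'n::finite) chart \<Rightarrow> 'p \<Rightarrow> real^'n" where
  "cmap c \<equiv> snd c"

definition cimg :: "('p, 'n::finite) chart \<Rightarrow> (real^'n) set" where
  "cimg c = cmap c ` cdom c"

definition cinv :: "('p, 'n::finite) chart \<Rightarrow> real^'n \<Rightarrow> 'p" where
  "cinv c = the_inv_into (cdom c) (cmap c)"

definition transition :: "('p, 'n::finite) chart \<Rightarrow> ('p, 'n) chart \<Rightarrow> real^'n \<Rightarrow> real^'n" where
  "transition c d = cmap d \<circ> cinv c"

definition overlap :: "('p, 'n::finite) chart \<Rightarrow> ('p, 'n) chart \<Rightarrow> (real^'n) set" where
  "overlap c d = cmap c ` (cdom c \<inter> cdom d)"

definition smooth_atlas ::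
  "('p::{t2_space, second_countable_topology}, 'n::finite) chart set \<Rightarrow> bool" where
  "smooth_atlas A \<longleftrightarrow>
     (\<Union>c\<in>A. cdom c) = UNIV \<and>
     (\<forall>c\<in>A. open (cdom c) \<and> open (cimg c) \<and>
             homeomorphism (cdom c) (cimg c) (cmap c) (cinv c)) \<and>
     (\<forall>c\<in>A. \<forall>d\<in>A. smooth_on (overlap c d) (transition c d))"

definition smooth_function ::
  "('p::{t2_space, second_countable_topology}, 'n::finite) chart set \<Rightarrow> ('p \<Rightarrow> real) \<Rightarrow> bool" where
  "smooth_function A f \<longleftrightarrow> (\<forall>c\<in>A. smooth_on (cimg c) (f \<circ> cinv c))"


section \<open>Riemannian metrics and almost Hermitian structures\<close>

text \<open>A tangent vector at a point is given in each chart around it by its component vector; the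
  component vectors in two charts correspond under the derivative of the transition map. A tensor
  field is a family of component matrices, indexed by the charts and depending on the coordinates
  of the point, that is compatible with the transition maps.\<close>

type_synonym 'n matrix_field = "real^'n \<Rightarrow> real^'n^'n"

definition minner :: "real^'n^'n \<Rightarrow> real^'n::finite \<Rightarrow> real^'n \<Rightarrow> real" where
  "minner G u v = u \<bullet> (G *v v)"

definition riemannian_manifold ::
  "('p::{t2_space, second_countable_topology}, 'n::finite) chart set \<Rightarrow>
   (('p, 'n) chart \<Rightarrow> 'n matrix_field) \<Rightarrow> bool" where
  "riemannian_manifold A g \<longleftrightarrow>
     smooth_atlas A \<and>
     (\<forall>c\<in>A. smooth_on (cimg c) (g c) \<and>
        (\<forall>x\<in>cimg c. (\<forall>u v. minner (g c x) u v = minner (g c x) v u) \<and>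
                     (\<forall>u. u \<noteq> 0 \<longrightarrow> minner (g c x) u u > 0))) \<and>
     (\<forall>c\<in>A. \<forall>d\<in>A. \<forall>x\<in>overlap c d. \<forall>u v.
        minner (g c x) u v =
        minner (g d (transition c d x)) (dif (transition c d) x u) (dif (transition c d) x v))"

definition almost_hermitian_manifold ::
  "('p::{t2_space, second_countable_topology}, 'n::finite) chart set \<Rightarrow>
   (('p, 'n) chart \<Rightarrow> 'n matrix_field) \<Rightarrow> (('p, 'n) chart \<Rightarrow> 'n matrix_field) \<Rightarrow> bool" where
  "almost_hermitian_manifold A g J \<longleftrightarrow>
     riemannian_manifold A g \<and>
     (\<forall>c\<in>A. smooth_on (cimg c) (J c) \<and>
        (\<forall>x\<in>cimg c. (\<forall>u. J c x *v (J c x *v u) = - u) \<and>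
                     (\<forall>u v. minner (g c x) (J c x *v u) (J c x *v v) = minner (g c x) u v))) \<and>
     (\<forall>c\<in>A. \<forall>d\<in>A. \<forall>x\<in>overlap c d. \<forall>u.
        dif (transition c d) x (J c x *v u) =
        J d (transition c d x) *v dif (transition c d) x u)"


section \<open>Levi-Civita connection and curvature in a chart\<close>

text \<open>In this section \<open>G\<close> is the component matrix of the metric in one chart, and vector fields on
  the chart are maps from coordinates to component vectors.\<close>

definition christoffel_symbol ::
  "'n::finite matrix_field \<Rightarrow> real^'n \<Rightarrow> 'n \<Rightarrow> 'n \<Rightarrow> 'n \<Rightarrow> real" where
  "christoffel_symbol G x k i j =
     1/2 * (\<Sum>l\<in>UNIV. matrix_inv (G x) $ k $ l *
       (pd i (\<lambda>y. G y $ j $ l) x + pd j (\<lambda>y. G y $ i $ l) x - pd l (\<lambda>y. G y $ i $ j) x))"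

definition christoffel ::
  "'n::finite matrix_field \<Rightarrow> real^'n \<Rightarrow> real^'n \<Rightarrow> real^'n \<Rightarrow> real^'n" where
  "christoffel G x u v =
     (\<chi> k. \<Sum>i\<in>UNIV. \<Sum>j\<in>UNIV. christoffel_symbol G x k i j * u $ i * v $ j)"

definition covd ::
  "'n::finite matrix_field \<Rightarrow> (real^'n \<Rightarrow> real^'n) \<Rightarrow> (real^'n \<Rightarrow> real^'n) \<Rightarrow> real^'n \<Rightarrow> real^'n" where
  "covd G X Y x = dif Y x (X x) + christoffel G x (X x) (Y x)"

definition lie_bracket ::
  "(real^'n::finite \<Rightarrow> real^'n) \<Rightarrow> (real^'n \<Rightarrow> real^'n) \<Rightarrow> real^'n \<Rightarrow> real^'n" where
  "lie_bracket X Y x = dif Y x (X x) - dif X x (Y x)"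

definition curvature_op ::
  "'n::finite matrix_field \<Rightarrow> (real^'n \<Rightarrow> real^'n) \<Rightarrow> (real^'n \<Rightarrow> real^'n) \<Rightarrow>
   (real^'n \<Rightarrow> real^'n) \<Rightarrow> real^'n \<Rightarrow> real^'n" where
  "curvature_op G X Y Z x =
     covd G X (covd G Y Z) x - covd G Y (covd G X Z) x - covd G (lie_bracket X Y) Z x"

text \<open>The curvature is tensorial, so its value on tangent vectors may be computed by extending them
  to vector fields with constant components.\<close>

definition curvature ::
  "'n::finite matrix_field \<Rightarrow> real^'n \<Rightarrow> real^'n \<Rightarrow> real^'n \<Rightarrow> real^'n \<Rightarrow> real^'n" where
  "curvature G x u v w = curvature_op G (\<lambda>_. u) (\<lambda>_. v) (\<lambda>_. w) x"

text \<open>Trace of a bilinear map with respect to the inner product with Gram matrix \<open>G\<close>.\<close>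

definition metric_trace ::
  "real^'n^'n \<Rightarrow> (real^'n::finite \<Rightarrow> real^'n \<Rightarrow> 'b::real_vector) \<Rightarrow> 'b" where
  "metric_trace G B =
     (\<Sum>i\<in>UNIV. \<Sum>j\<in>UNIV. (matrix_inv G $ i $ j) *\<^sub>R B (axis i 1) (axis j 1))"

definition ricci :: "'n::finite matrix_field \<Rightarrow> real^'n \<Rightarrow> real^'n \<Rightarrow> real^'n \<Rightarrow> real" where
  "ricci G x v w = trace (matrix (\<lambda>u. curvature G x u v w))"

definition scalar_curvature :: "'n::finite matrix_field \<Rightarrow> real^'n \<Rightarrow> real" where
  "scalar_curvature G x = metric_trace (G x) (ricci G x)"


section \<open>Generalized complex space forms\<close>

definition curv_R1 ::
  "real^'n^'n \<Rightarrow> real^'n::finite \<Rightarrow> real^'n \<Rightarrow> real^'n \<Rightarrow> real^'n" where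
  "curv_R1 G u v w = minner G v w *\<^sub>R u - minner G u w *\<^sub>R v"

definition curv_R2 ::
  "real^'n^'n \<Rightarrow> real^'n^'n \<Rightarrow> real^'n::finite \<Rightarrow> real^'n \<Rightarrow> real^'n \<Rightarrow> real^'n" where
  "curv_R2 G J u v w =
     minner G (J *v v) w *\<^sub>R (J *v u) - minner G (J *v u) w *\<^sub>R (J *v v)
     + (2 * minner G (J *v v) u) *\<^sub>R (J *v w)"

definition generalized_complex_space_form ::
  "('p::{t2_space, second_countable_topology}, 'n::finite) chart set \<Rightarrow>
   (('p, 'n) chart \<Rightarrow> 'n matrix_field) \<Rightarrow> (('p, 'n) chart \<Rightarrow> 'n matrix_field) \<Rightarrow>
   ('p \<Rightarrow> real) \<Rightarrow> ('p \<Rightarrow> real) \<Rightarrow> bool" where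
  "generalized_complex_space_form A g J \<alpha> \<beta> \<longleftrightarrow>
     almost_hermitian_manifold A g J \<and> smooth_function A \<alpha> \<and> smooth_function A \<beta> \<and>
     (\<forall>c\<in>A. \<forall>x\<in>cimg c. \<forall>u v w.
        curvature (g c) x u v w =
        \<alpha> (cinv c x) *\<^sub>R curv_R1 (g c x) u v w + \<beta> (cinv c x) *\<^sub>R curv_R2 (g c x) (J c x) u v w)"

definition negative_scalar_curvature ::
  "('p, 'n::finite) chart set \<Rightarrow> (('p, 'n) chart \<Rightarrow> 'n matrix_field) \<Rightarrow> bool" where
  "negative_scalar_curvature A g \<longleftrightarrow> (\<forall>c\<in>A. \<forall>x\<in>cimg c. scalar_curvature (g c) x < 0)"


section \<open>Isometric immersions\<close>

definition local_rep ::
  "('p, 'm::finite) chart \<Rightarrow> ('q, 'n::finite) chart \<Rightarrow> ('p \<Rightarrow> 'q) \<Rightarrow> real^'m \<Rightarrow> real^'n" where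
  "local_rep c d \<psi> = cmap d \<circ> \<psi> \<circ> cinv c"

definition rep_dom ::
  "('p, 'm::finite) chart \<Rightarrow> ('q, 'n::finite) chart \<Rightarrow> ('p \<Rightarrow> 'q) \<Rightarrow> (real^'m) set" where
  "rep_dom c d \<psi> = cmap c ` (cdom c \<inter> \<psi> -` cdom d)"

definition smooth_map ::
  "('p::{t2_space, second_countable_topology}, 'm::finite) chart set \<Rightarrow>
   ('q::{t2_space, second_countable_topology}, 'n::finite) chart set \<Rightarrow> ('p \<Rightarrow> 'q) \<Rightarrow> bool" where
  "smooth_map A B \<psi> \<longleftrightarrow>
     continuous_on UNIV \<psi> \<and> (\<forall>c\<in>A. \<forall>d\<in>B. smooth_on (rep_dom c d \<psi>) (local_rep c d \<psi>))"

definition isometric_immersion ::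
  "('p::{t2_space, second_countable_topology}, 'm::finite) chart set \<Rightarrow>
   (('p, 'm) chart \<Rightarrow> 'm matrix_field) \<Rightarrow>
   ('q::{t2_space, second_countable_topology}, 'n::finite) chart set \<Rightarrow>
   (('q, 'n) chart \<Rightarrow> 'n matrix_field) \<Rightarrow> ('p \<Rightarrow> 'q) \<Rightarrow> bool" where
  "isometric_immersion A g B h \<psi> \<longleftrightarrow>
     riemannian_manifold A g \<and> riemannian_manifold B h \<and> smooth_map A B \<psi> \<and>
     (\<forall>c\<in>A. \<forall>d\<in>B. \<forall>x\<in>rep_dom c d \<psi>.
        inj (dif (local_rep c d \<psi>) x) \<and>
        (\<forall>u v. minner (h d (local_rep c d \<psi> x)) (dif (local_rep c d \<psi>) x u) (dif (local_rep c d \<psi>) x v)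
               = minner (g c x) u v))"


section \<open>Tension and bitension field in a pair of charts\<close>

text \<open>\<open>G\<close> and \<open>H\<close> are the metric components in a chart of the source and of the target, and \<open>F\<close> is
  the local representative of the map. A section of the pullback of the target's tangent bundle is a
  map \<open>V\<close> from source coordinates to target component vectors. The first definition is the pullback
  of the Levi-Civita connection of \<open>H\<close>.\<close>

definition pullback_covd ::
  "'n::finite matrix_field \<Rightarrow> (real^'m::finite \<Rightarrow> real^'n) \<Rightarrow>
   (real^'m \<Rightarrow> real^'m) \<Rightarrow> (real^'m \<Rightarrow> real^'n) \<Rightarrow> real^'m \<Rightarrow> real^'n" where
  "pullback_covd H F X V x = dif V x (X x) + christoffel H (F x) (dif F x (X x)) (V x)"

text \<open>The second fundamental form \<open>\<nabla>d\<psi>\<close> and the second covariant derivative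
  \<open>\<nabla>\<^sup>2V\<close> are tensorial in their two tangent vectors, which are extended with
  constant components. By the Gauss formula, for an isometric immersion \<open>\<nabla>d\<psi>\<close> is the normal part
  of the ambient derivative.\<close>

definition second_fundamental_form ::
  "'m::finite matrix_field \<Rightarrow> 'n::finite matrix_field \<Rightarrow> (real^'m \<Rightarrow> real^'n) \<Rightarrow>
   real^'m \<Rightarrow> real^'m \<Rightarrow> real^'m \<Rightarrow> real^'n" where
  "second_fundamental_form G H F x u v =
     pullback_covd H F (\<lambda>_. u) (\<lambda>y. dif F y v) x - dif F x (covd G (\<lambda>_. u) (\<lambda>_. v) x)"

definition tension ::
  "'m::finite matrix_field \<Rightarrow> 'n::finite matrix_field \<Rightarrow> (real^'m \<Rightarrow> real^'n) \<Rightarrow>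
   real^'m \<Rightarrow> real^'n" where
  "tension G H F x = metric_trace (G x) (second_fundamental_form G H F x)"

definition mean_curvature_vector ::
  "'m::finite matrix_field \<Rightarrow> 'n::finite matrix_field \<Rightarrow> (real^'m \<Rightarrow> real^'n) \<Rightarrow>
   real^'m \<Rightarrow> real^'n" where
  "mean_curvature_vector G H F x =
     (1 / real CARD('m)) *\<^sub>R metric_trace (G x) (second_fundamental_form G H F x)"

definition second_covd ::
  "'m::finite matrix_field \<Rightarrow> 'n::finite matrix_field \<Rightarrow> (real^'m \<Rightarrow> real^'n) \<Rightarrow>
   (real^'m \<Rightarrow> real^'n) \<Rightarrow> real^'m \<Rightarrow> real^'m \<Rightarrow> real^'m \<Rightarrow> real^'n" where
  "second_covd G H F V x u v =
     pullback_covd H F (\<lambda>_. u) (pullback_covd H F (\<lambda>_. v) V) x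
     - pullback_covd H F (covd G (\<lambda>_. u) (\<lambda>_. v)) V x"

definition rough_laplacian ::
  "'m::finite matrix_field \<Rightarrow> 'n::finite matrix_field \<Rightarrow> (real^'m \<Rightarrow> real^'n) \<Rightarrow>
   (real^'m \<Rightarrow> real^'n) \<Rightarrow> real^'m \<Rightarrow> real^'n" where
  "rough_laplacian G H F V x = metric_trace (G x) (second_covd G H F V x)"

definition bitension ::
  "'m::finite matrix_field \<Rightarrow> 'n::finite matrix_field \<Rightarrow> (real^'m \<Rightarrow> real^'n) \<Rightarrow>
   real^'m \<Rightarrow> real^'n" where
  "bitension G H F x =
     rough_laplacian G H F (tension G H F) x
     - metric_trace (G x)
         (\<lambda>u v. curvature H (F x) (dif F x u) (tension G H F x) (dif F x v))"


section \<open>Harmonic and biharmonic maps, constant mean curvature\<close>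

definition harmonic ::
  "('p, 'm::finite) chart set \<Rightarrow> (('p, 'm) chart \<Rightarrow> 'm matrix_field) \<Rightarrow>
   ('q, 'n::finite) chart set \<Rightarrow> (('q, 'n) chart \<Rightarrow> 'n matrix_field) \<Rightarrow> ('p \<Rightarrow> 'q) \<Rightarrow> bool" where
  "harmonic A g B h \<psi> \<longleftrightarrow>
     (\<forall>c\<in>A. \<forall>d\<in>B. \<forall>x\<in>rep_dom c d \<psi>. tension (g c) (h d) (local_rep c d \<psi>) x = 0)"

definition biharmonic ::
  "('p, 'm::finite) chart set \<Rightarrow> (('p, 'm) chart \<Rightarrow> 'm matrix_field) \<Rightarrow>
   ('q, 'n::finite) chart set \<Rightarrow> (('q, 'n) chart \<Rightarrow> 'n matrix_field) \<Rightarrow> ('p \<Rightarrow> 'q) \<Rightarrow> bool" where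
  "biharmonic A g B h \<psi> \<longleftrightarrow>
     (\<forall>c\<in>A. \<forall>d\<in>B. \<forall>x\<in>rep_dom c d \<psi>. bitension (g c) (h d) (local_rep c d \<psi>) x = 0)"

definition proper_biharmonic ::
  "('p, 'm::finite) chart set \<Rightarrow> (('p, 'm) chart \<Rightarrow> 'm matrix_field) \<Rightarrow>
   ('q, 'n::finite) chart set \<Rightarrow> (('q, 'n) chart \<Rightarrow> 'n matrix_field) \<Rightarrow> ('p \<Rightarrow> 'q) \<Rightarrow> bool" where
  "proper_biharmonic A g B h \<psi> \<longleftrightarrow> biharmonic A g B h \<psi> \<and> \<not> harmonic A g B h \<psi>"

definition constant_mean_curvature ::
  "('p, 'm::finite) chart set \<Rightarrow> (('p, 'm) chart \<Rightarrow> 'm matrix_field) \<Rightarrow>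
   ('q, 'n::finite) chart set \<Rightarrow> (('q, 'n) chart \<Rightarrow> 'n matrix_field) \<Rightarrow> ('p \<Rightarrow> 'q) \<Rightarrow> bool" where
  "constant_mean_curvature A g B h \<psi> \<longleftrightarrow>
     (\<exists>C. \<forall>c\<in>A. \<forall>d\<in>B. \<forall>x\<in>rep_dom c d \<psi>.
        let F = local_rep c d \<psi>; V = mean_curvature_vector (g c) (h d) F x
        in sqrt (minner (h d (F x)) V V) = C)"

end

theory Submission
  imports Defs
begin

text \<open>
  Let \<open>\<tau>\<close> be the tension field of a biharmonic hypersurface of constant mean curvature. Since
  \<open>\<bar>\<tau>\<bar>\<close> is a constant multiple of \<open>\<bar>H\<bar>\<close>, differentiating \<open>\<bar>\<tau>\<bar>\<^sup>2\<close> twice and taking the trace gives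
  \<open>\<langle>\<Delta>\<tau>, \<tau>\<rangle> = -\<bar>\<nabla>\<tau>\<bar>\<^sup>2 \<le> 0\<close> (\<open>rough_laplacian_constant_norm\<close>). By the biharmonic equation, \<open>\<Delta>\<tau>\<close> is
  the trace of \<open>R(dF \<cdot>, \<tau>) dF \<cdot>\<close>. As \<open>\<tau>\<close> is normal (\<open>second_fundamental_form_normal\<close>) and the
  codimension is one, \<open>J\<tau>\<close> is tangent, so the trace sees the whole of \<open>J\<tau>\<close>, and its product with
  \<open>\<tau>\<close> is \<open>-(m \<alpha> + 3 \<beta>) \<bar>\<tau>\<bar>\<^sup>2\<close>, where \<open>m\<close> is the dimension of the hypersurface
  (\<open>trace_R_hypersurface\<close>). The scalar curvature of the ambient space is
  \<open>(m + 1) (m \<alpha> + 3 \<beta>)\<close> (\<open>space_form_scalar_curvature\<close>). If it is negative, then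
  \<open>0 \<ge> \<langle>\<Delta>\<tau>, \<tau>\<rangle> = -(m \<alpha> + 3 \<beta>) \<bar>\<tau>\<bar>\<^sup>2\<close> forces \<open>\<tau> = 0\<close>. For \<open>m = 3\<close> the factor is \<open>3 (\<alpha> + \<beta>)\<close>.

  Every step is pointwise or local, so the argument takes place in a pair of charts. The second
  derivative of \<open>\<bar>\<tau>\<bar>\<^sup>2\<close> involves four derivatives of the immersion, and \<open>\<tau>\<close> is composed of the immersion,
  the metrics and the inverses of their matrices; this is what the closure properties of smooth
  maps are for. The symmetry of second derivatives makes the second fundamental form symmetric,
  on which the normality of \<open>\<tau>\<close> rests.
\<close>


section \<open>Closure properties of smooth maps\<close>

lemma has_derivative_dif: "f differentiable (at x) \<Longrightarrow> (f has_derivative dif f x) (at x)"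
  by (simp add: frechet_derivative_works)

lemma dif_eqI: "(f has_derivative f') (at x) \<Longrightarrow> dif f x = f'"
  by (metis frechet_derivative_at)

lemma times_differentiable_cong:
  assumes "open S" "times_differentiable_on k S f" "\<And>x. x \<in> S \<Longrightarrow> f x = g x"
  shows "times_differentiable_on k S g"
  using assms(2,3)
proof (induction k arbitrary: f g)
  case 0
  then show ?case by (simp cong: continuous_on_cong)
next
  case (Suc k)
  have g: "(g has_derivative dif f x) (at x)" if "x \<in> S" for x
  proof (rule has_derivative_transform_within_open[OF _ assms(1) that Suc.prems(2)])
    show "(f has_derivative dif f x) (at x)"
      using Suc.prems(1) that by (simp add: has_derivative_dif)
  qed
  have "times_differentiable_on k S (\<lambda>x. dif g x v)" for v
  proof (rule Suc.IH)
    show "times_differentiable_on k S (\<lambda>x. dif f x v)"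
      using Suc.prems(1) by simp
    show "dif f x v = dif g x v" if "x \<in> S" for x
      by (simp add: dif_eqI[OF g[OF that]])
  qed
  with g show ?case
    by (auto simp: differentiable_def)
qed

lemma times_differentiable_SucI:
  assumes "open S" "\<And>x. x \<in> S \<Longrightarrow> (f has_derivative f' x) (at x)"
    and "\<And>v. times_differentiable_on k S (\<lambda>x. f' x v)"
  shows "times_differentiable_on (Suc k) S f"
proof -
  have "times_differentiable_on k S (\<lambda>x. dif f x v)" for v
    by (rule times_differentiable_cong[OF assms(1) assms(3)[of v]]) (simp add: dif_eqI[OF assms(2)])
  with assms(2) show ?thesis
    by (auto simp: differentiable_def)
qed

lemma times_differentiable_Suc_has_derivative:
  assumes "times_differentiable_on (Suc k) S f" "x \<in> S"
  shows "(f has_derivative dif f x) (at x)"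
  using assms has_derivative_dif by auto

lemma times_differentiable_Suc_imp:
  "times_differentiable_on (Suc k) S f \<Longrightarrow> times_differentiable_on k S f"
proof (induction k arbitrary: f)
  case 0
  then show ?case
    by (auto intro!: continuous_at_imp_continuous_on differentiable_imp_continuous_within)
next
  case (Suc k)
  have "times_differentiable_on k S (\<lambda>x. dif f x v)" for v
    using Suc.prems by (intro Suc.IH) simp
  with Suc.prems show ?case by simp
qed

lemma times_differentiable_subset:
  "times_differentiable_on k S f \<Longrightarrow> T \<subseteq> S \<Longrightarrow> times_differentiable_on k T f"
  by (induction k arbitrary: f) (auto intro: continuous_on_subset)

lemma times_differentiable_const: "times_differentiable_on k S (\<lambda>x. c)"
  by (induction k arbitrary: c) auto

lemma times_differentiable_bounded_linear:
  assumes "bounded_linear L" "open S" "times_differentiable_on k S f"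
  shows "times_differentiable_on k S (\<lambda>x. L (f x))"
  using assms(3)
proof (induction k arbitrary: f)
  case 0
  then show ?case
    using assms(1) by (auto intro: bounded_linear.continuous_on)
next
  case (Suc k)
  show ?case
  proof (rule times_differentiable_SucI[OF assms(2)])
    fix x assume "x \<in> S"
    then show "((\<lambda>x. L (f x)) has_derivative (\<lambda>v. L (dif f x v))) (at x)"
      using times_differentiable_Suc_has_derivative[OF Suc.prems]
      by (auto intro: bounded_linear.has_derivative[OF assms(1)])
  qed (use Suc in auto)
qed

lemma times_differentiable_add:
  assumes "open S" "times_differentiable_on k S f" "times_differentiable_on k S g"
  shows "times_differentiable_on k S (\<lambda>x. f x + g x)"
  using assms(2,3)
proof (induction k arbitrary: f g)
  case 0
  then show ?case by (auto intro: continuous_intros)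
next
  case (Suc k)
  show ?case
  proof (rule times_differentiable_SucI[OF assms(1)])
    fix x assume "x \<in> S"
    then show "((\<lambda>x. f x + g x) has_derivative (\<lambda>v. dif f x v + dif g x v)) (at x)"
      using Suc.prems[THEN times_differentiable_Suc_has_derivative]
      by (auto intro: has_derivative_add)
  qed (use Suc in auto)
qed

lemma times_differentiable_bilinear:
  assumes "bounded_bilinear B" "open S"
    and "times_differentiable_on k S f" "times_differentiable_on k S g"
  shows "times_differentiable_on k S (\<lambda>x. B (f x) (g x))"
  using assms(3,4)
proof (induction k arbitrary: f g)
  case 0
  then show ?case
    using assms(1) by (auto intro: bounded_bilinear.continuous_on)
next
  case (Suc k)
  show ?case
  proof (rule times_differentiable_SucI[OF assms(2)])
    fix x assume "x \<in> S"
    then show "((\<lambda>x. B (f x) (g x)) has_derivative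
        (\<lambda>v. B (f x) (dif g x v) + B (dif f x v) (g x))) (at x)"
      using Suc.prems[THEN times_differentiable_Suc_has_derivative]
      by (auto intro: bounded_bilinear.FDERIV[OF assms(1)])
  next
    fix v
    show "times_differentiable_on k S (\<lambda>x. B (f x) (dif g x v) + B (dif f x v) (g x))"
      using Suc.prems Suc.prems[THEN times_differentiable_Suc_imp]
      by (intro times_differentiable_add[OF assms(2)] Suc.IH) auto
  qed
qed

lemma times_differentiable_sum:
  assumes "open S" "\<And>i. i \<in> I \<Longrightarrow> times_differentiable_on k S (f i)"
  shows "times_differentiable_on k S (\<lambda>x. \<Sum>i\<in>I. f i x)"
  using assms(2)
  by (induction I rule: infinite_finite_induct)
    (auto intro: times_differentiable_const times_differentiable_add[OF assms(1)])

text \<open>In the inductive step the chain rule is expanded over a basis of the middle space, which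
  exhibits the derivative of the composition as a sum of products of maps that are smooth of the
  lower order.\<close>

lemma times_differentiable_compose:
  fixes f :: "'b::euclidean_space \<Rightarrow> 'c::real_normed_vector"
  assumes "open S" "g ` S \<subseteq> T"
    and "times_differentiable_on k T f" "times_differentiable_on k S g"
  shows "times_differentiable_on k S (\<lambda>x. f (g x))"
  using assms(3,4)
proof (induction k arbitrary: f)
  case 0
  then show ?case
    using assms(2) continuous_on_compose2 by auto
next
  case (Suc k)
  show ?case
  proof (rule times_differentiable_SucI[OF assms(1)])
    fix x assume x: "x \<in> S"
    then have f: "(f has_derivative dif f (g x)) (at (g x))"
      using Suc.prems(1) assms(2) by (intro times_differentiable_Suc_has_derivative[of k T]) auto
    have g: "(g has_derivative dif g x) (at x)"
      using Suc.prems(2) x by (rule times_differentiable_Suc_has_derivative)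
    have "dif f (g x) (dif g x v) = (\<Sum>b\<in>Basis. (dif g x v \<bullet> b) *\<^sub>R dif f (g x) b)" for v
      using linear_sum[OF has_derivative_linear[OF f], of "\<lambda>b. (dif g x v \<bullet> b) *\<^sub>R b" Basis]
      by (simp add: euclidean_representation linear_cmul[OF has_derivative_linear[OF f]])
    then show "((\<lambda>x. f (g x)) has_derivative
        (\<lambda>v. \<Sum>b\<in>Basis. (dif g x v \<bullet> b) *\<^sub>R dif f (g x) b)) (at x)"
      using diff_chain_at[OF g f] by (simp add: o_def)
  next
    fix v
    have "times_differentiable_on k S (\<lambda>x. dif g x v \<bullet> b)" for b
      using Suc.prems(2)
      by (intro times_differentiable_bounded_linear[OF bounded_linear_inner_left assms(1)]) auto
    moreover have "times_differentiable_on k S (\<lambda>x. dif f (g x) b)" for b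
      using Suc.prems(1) times_differentiable_Suc_imp[OF Suc.prems(2)]
      by (intro Suc.IH[of "\<lambda>y. dif f y b"]) simp_all
    ultimately show "times_differentiable_on k S
        (\<lambda>x. \<Sum>b\<in>Basis. (dif g x v \<bullet> b) *\<^sub>R dif f (g x) b)"
      by (intro times_differentiable_sum[OF assms(1)]
          times_differentiable_bilinear[OF bounded_bilinear_scaleR assms(1)])
  qed
qed

lemma times_differentiable_inverse:
  fixes f :: "'a::real_normed_vector \<Rightarrow> real"
  assumes "open S" "\<And>x. x \<in> S \<Longrightarrow> f x \<noteq> 0" "times_differentiable_on k S f"
  shows "times_differentiable_on k S (\<lambda>x. inverse (f x))"
  using assms(3)
proof (induction k)
  case 0
  then show ?case
    using assms(2) by (auto intro: continuous_intros)
next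
  case (Suc k)
  show ?case
  proof (rule times_differentiable_SucI[OF assms(1)])
    fix x assume "x \<in> S"
    (* the derivative is written with products only, so that the product rule and the induction
       hypothesis show it to be differentiable k times *)
    then show "((\<lambda>x. inverse (f x)) has_derivative
        (\<lambda>v. (-1) * ((inverse (f x) * inverse (f x)) * dif f x v))) (at x)"
      using Suc.prems[THEN times_differentiable_Suc_has_derivative] assms(2)
      by (auto intro!: derivative_eq_intros)
  next
    fix v
    show "times_differentiable_on k S (\<lambda>x. (-1) * ((inverse (f x) * inverse (f x)) * dif f x v))"
      using Suc.prems Suc.prems[THEN times_differentiable_Suc_imp]
      by (intro times_differentiable_bilinear[OF bounded_bilinear_mult assms(1)]
          times_differentiable_const Suc.IH) auto
  qed
qed

lemma smooth_on_cong: "open S \<Longrightarrow> smooth_on S f \<Longrightarrow> (\<And>x. x \<in> S \<Longrightarrow> f x = g x) \<Longrightarrow> smooth_on S g"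
  unfolding smooth_on_def using times_differentiable_cong[of S _ f g] by blast

lemma smooth_on_subset: "smooth_on S f \<Longrightarrow> T \<subseteq> S \<Longrightarrow> smooth_on T f"
  unfolding smooth_on_def using times_differentiable_subset[of _ S f T] by blast

lemma smooth_on_const: "smooth_on S (\<lambda>x. c)"
  unfolding smooth_on_def using times_differentiable_const by blast

lemma smooth_on_bounded_linear:
  "bounded_linear L \<Longrightarrow> open S \<Longrightarrow> smooth_on S f \<Longrightarrow> smooth_on S (\<lambda>x. L (f x))"
  unfolding smooth_on_def using times_differentiable_bounded_linear[of L S _ f] by blast

lemma smooth_on_add:
  "open S \<Longrightarrow> smooth_on S f \<Longrightarrow> smooth_on S g \<Longrightarrow> smooth_on S (\<lambda>x. f x + g x)"
  unfolding smooth_on_def using times_differentiable_add[of S _ f g] by blast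

lemma smooth_on_bilinear:
  "bounded_bilinear B \<Longrightarrow> open S \<Longrightarrow> smooth_on S f \<Longrightarrow> smooth_on S g \<Longrightarrow>
    smooth_on S (\<lambda>x. B (f x) (g x))"
  unfolding smooth_on_def using times_differentiable_bilinear[of B S _ f g] by blast

lemma smooth_on_sum:
  "open S \<Longrightarrow> (\<And>i. i \<in> I \<Longrightarrow> smooth_on S (f i)) \<Longrightarrow> smooth_on S (\<lambda>x. \<Sum>i\<in>I. f i x)"
  unfolding smooth_on_def using times_differentiable_sum[of S I _ f] by blast

lemma smooth_on_compose:
  fixes f :: "'b::euclidean_space \<Rightarrow> 'c::real_normed_vector"
  shows "open S \<Longrightarrow> smooth_on T f \<Longrightarrow> smooth_on S g \<Longrightarrow> g ` S \<subseteq> T \<Longrightarrow> smooth_on S (\<lambda>x. f (g x))"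
  unfolding smooth_on_def using times_differentiable_compose[of S g T _ f] by blast

lemma smooth_on_inverse:
  fixes f :: "'a::real_normed_vector \<Rightarrow> real"
  shows "open S \<Longrightarrow> smooth_on S f \<Longrightarrow> (\<And>x. x \<in> S \<Longrightarrow> f x \<noteq> 0) \<Longrightarrow> smooth_on S (\<lambda>x. inverse (f x))"
  unfolding smooth_on_def using times_differentiable_inverse[of S f] by blast

lemma smooth_on_dif: "smooth_on S f \<Longrightarrow> smooth_on S (\<lambda>x. dif f x v)"
  unfolding smooth_on_def
proof
  fix k
  assume "\<forall>k. times_differentiable_on k S f"
  then have "times_differentiable_on (Suc k) S f" ..
  then show "times_differentiable_on k S (\<lambda>x. dif f x v)" by simp
qed

lemma smooth_on_has_derivative: "smooth_on S f \<Longrightarrow> x \<in> S \<Longrightarrow> (f has_derivative dif f x) (at x)"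
  unfolding smooth_on_def by (blast intro: times_differentiable_Suc_has_derivative)

lemma smooth_on_linear_dif: "smooth_on S f \<Longrightarrow> x \<in> S \<Longrightarrow> linear (dif f x)"
  using smooth_on_has_derivative has_derivative_linear by blast

lemma smooth_on_imp_continuous_on: "smooth_on S f \<Longrightarrow> continuous_on S f"
  unfolding smooth_on_def using times_differentiable_on.simps(1) by blast

lemmas smooth_on_scaleR = smooth_on_bilinear[OF bounded_bilinear_scaleR]
lemmas smooth_on_mult = smooth_on_bilinear[OF bounded_bilinear_mult]
lemmas smooth_on_vec_nth = smooth_on_bounded_linear[OF bounded_linear_vec_nth]

lemma smooth_on_diff:
  assumes "open S" "smooth_on S f" "smooth_on S g"
  shows "smooth_on S (\<lambda>x. f x - g x)"
  using smooth_on_add[OF assms(1,2) smooth_on_scaleR[OF assms(1) smooth_on_const assms(3)], of "-1"]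
  by simp

lemma smooth_on_prod:
  fixes f :: "'i \<Rightarrow> 'a::real_normed_vector \<Rightarrow> real"
  assumes "open S" "\<And>i. i \<in> I \<Longrightarrow> smooth_on S (f i)"
  shows "smooth_on S (\<lambda>x. \<Prod>i\<in>I. f i x)"
  using assms(2)
  by (induction I rule: infinite_finite_induct)
    (auto intro: smooth_on_const smooth_on_mult[OF assms(1)])

lemma smooth_on_vec_lambda:
  fixes f :: "'i::finite \<Rightarrow> 'a::real_normed_vector \<Rightarrow> real"
  assumes "open S" "\<And>i. smooth_on S (f i)"
  shows "smooth_on S (\<lambda>x. \<chi> i. f i x)"
proof -
  have "(\<Sum>i\<in>UNIV. f i x *\<^sub>R axis i 1) = (\<chi> i. f i x)" for x
    by (simp add: vec_eq_iff axis_def if_distrib cong: if_cong)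
  moreover have "smooth_on S (\<lambda>x. \<Sum>i\<in>UNIV. f i x *\<^sub>R (axis i 1 :: real^'i))"
    using assms by (intro smooth_on_sum smooth_on_scaleR smooth_on_const)
  ultimately show ?thesis
    by (metis (mono_tags, lifting) assms(1) smooth_on_cong)
qed

lemma linear_eq_sum_axis:
  fixes L :: "real^'n::finite \<Rightarrow> 'b::real_vector"
  assumes "linear L"
  shows "L v = (\<Sum>i\<in>UNIV. v $ i *\<^sub>R L (axis i 1))"
proof -
  have "v = (\<Sum>i\<in>UNIV. v $ i *\<^sub>R axis i 1)"
    by (simp add: vec_eq_iff axis_def if_distrib cong: if_cong)
  then show ?thesis
    using linear_sum[OF assms, of "\<lambda>i. v $ i *\<^sub>R axis i 1" UNIV] linear_cmul[OF assms] by simp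
qed

lemma smooth_on_dif_apply:
  fixes F :: "real^'m::finite \<Rightarrow> 'b::real_normed_vector"
  assumes "open S" "smooth_on S F" "smooth_on S V"
  shows "smooth_on S (\<lambda>x. dif F x (V x))"
proof (rule smooth_on_cong[OF assms(1)])
  show "smooth_on S (\<lambda>x. \<Sum>i\<in>UNIV. V x $ i *\<^sub>R dif F x (axis i 1))"
    using assms by (intro smooth_on_sum smooth_on_scaleR smooth_on_vec_nth smooth_on_dif)
  show "(\<Sum>i\<in>UNIV. V x $ i *\<^sub>R dif F x (axis i 1)) = dif F x (V x)" if "x \<in> S" for x
    using linear_eq_sum_axis[OF smooth_on_linear_dif[OF assms(2) that]] by metis
qed

lemma matrix_mul_matrix_inv: "invertible A \<Longrightarrow> A ** matrix_inv A = mat 1"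
  unfolding invertible_def matrix_inv_def by (rule someI2_ex) auto

text \<open>Cramer's rule writes the entries of the inverse as quotients of polynomials.\<close>

lemma smooth_on_matrix_inv:
  fixes G :: "'a::real_normed_vector \<Rightarrow> real^'n^'n::finite"
  assumes "open S" "smooth_on S G" "\<And>x. x \<in> S \<Longrightarrow> invertible (G x)"
  shows "smooth_on S (\<lambda>x. matrix_inv (G x) $ k $ l)"
proof -
  have det: "smooth_on S (\<lambda>x. det (\<chi> i j. f i j x))"
    if "\<And>i j. smooth_on S (f i j)" for f :: "'n \<Rightarrow> 'n \<Rightarrow> 'a \<Rightarrow> real"
    unfolding det_def using that assms(1)
    by (auto intro!: smooth_on_sum smooth_on_mult smooth_on_prod smooth_on_const)
  have G: "smooth_on S (\<lambda>x. G x $ i $ j)" for i j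
    using assms by (intro smooth_on_vec_nth)
  have "smooth_on S (\<lambda>x. det (\<chi> i j. if j = k then axis l 1 $ i else G x $ i $ j))"
  proof (rule det)
    show "smooth_on S (\<lambda>x. if j = k then axis l 1 $ i else G x $ i $ j)" for i j
      by (cases "j = k") (simp_all add: G smooth_on_const)
  qed
  moreover have "smooth_on S (\<lambda>x. det (G x))"
    using det[of "\<lambda>i j x. G x $ i $ j"] G by (simp add: vec_lambda_eta)
  moreover have nz: "det (G x) \<noteq> 0" if "x \<in> S" for x
    using assms(3)[OF that] by (simp add: invertible_det_nz)
  ultimately have "smooth_on S (\<lambda>x. det (\<chi> i j. if j = k then axis l 1 $ i else G x $ i $ j)
      * inverse (det (G x)))"
    using assms(1) by (intro smooth_on_mult smooth_on_inverse)
  then show ?thesis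
  proof (rule smooth_on_cong[OF assms(1)])
    fix x assume x: "x \<in> S"
    have "G x *v (matrix_inv (G x) *v axis l 1) = axis l 1"
      using assms(3)[OF x] by (simp add: matrix_vector_mul_assoc matrix_mul_matrix_inv)
    then have "(matrix_inv (G x) *v axis l 1) $ k
        = det (\<chi> i j. if j = k then axis l 1 $ i else G x $ i $ j) / det (G x)"
      using cramer[OF nz[OF x]] by simp
    then show "det (\<chi> i j. if j = k then axis l 1 $ i else G x $ i $ j) * inverse (det (G x))
        = matrix_inv (G x) $ k $ l"
      by (simp add: matrix_vector_mult_basis column_def divide_inverse)
  qed
qed


section \<open>Symmetry of the second derivative\<close>

lemma dif_cong_open:
  assumes "open S" "x \<in> S" "f differentiable (at x)" "\<And>y. y \<in> S \<Longrightarrow> f y = g y"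
  shows "dif f x = dif g x"
  using has_derivative_transform_within_open[OF has_derivative_dif[OF assms(3)] assms(1,2,4)]
  by (simp add: dif_eqI)

lemma smooth_on_differentiable: "smooth_on S f \<Longrightarrow> x \<in> S \<Longrightarrow> f differentiable (at x)"
  using smooth_on_has_derivative differentiable_def by blast

lemma smooth_on_line_derivative:
  fixes f :: "'a::real_normed_vector \<Rightarrow> real"
  assumes "smooth_on S f" "p + s *\<^sub>R u \<in> S"
  shows "((\<lambda>s. f (p + s *\<^sub>R u)) has_real_derivative dif f (p + s *\<^sub>R u) u) (at s)"
proof -
  have "((\<lambda>s. p + s *\<^sub>R u) has_derivative (\<lambda>t. t *\<^sub>R u)) (at s)"
    by (auto intro!: derivative_eq_intros)
  from diff_chain_at[OF this smooth_on_has_derivative[OF assms]]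
  have "((\<lambda>s. f (p + s *\<^sub>R u)) has_derivative (\<lambda>t. dif f (p + s *\<^sub>R u) (t *\<^sub>R u))) (at s)"
    by (simp add: o_def)
  moreover have "dif f (p + s *\<^sub>R u) (t *\<^sub>R u) = dif f (p + s *\<^sub>R u) u * t" for t
    using linear_cmul[OF smooth_on_linear_dif[OF assms]] by simp
  ultimately show ?thesis
    by (simp add: has_field_derivative_def)
qed

text \<open>Two applications of the mean value theorem turn the mixed difference of \<open>f\<close> over a
  parallelogram into a mixed derivative at some point of it.\<close>

lemma mixed_difference_mean_value:
  fixes f :: "'a::real_normed_vector \<Rightarrow> real"
  assumes "smooth_on S f" "0 < h"
    and S: "\<And>s t. 0 \<le> s \<Longrightarrow> s \<le> h \<Longrightarrow> 0 \<le> t \<Longrightarrow> t \<le> h \<Longrightarrow> x + s *\<^sub>R u + t *\<^sub>R v \<in> S"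
  shows "\<exists>s t. 0 < s \<and> s < h \<and> 0 < t \<and> t < h \<and>
    f (x + h *\<^sub>R u + h *\<^sub>R v) - f (x + h *\<^sub>R u) - (f (x + h *\<^sub>R v) - f x)
      = h * (h * dif (\<lambda>y. dif f y u) (x + s *\<^sub>R u + t *\<^sub>R v) v)"
proof -
  let ?\<phi> = "\<lambda>s. f ((x + h *\<^sub>R v) + s *\<^sub>R u) - f (x + s *\<^sub>R u)"
  have "(?\<phi> has_real_derivative
      dif f ((x + h *\<^sub>R v) + s *\<^sub>R u) u - dif f (x + s *\<^sub>R u) u) (at s)"
    if "0 \<le> s" "s \<le> h" for s
    using that S[of s h] S[of s 0] assms(2)
    by (intro DERIV_diff smooth_on_line_derivative[OF assms(1)]) (auto simp: algebra_simps)
  from MVT2[OF assms(2) this] obtain s where s: "0 < s" "s < h"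
    "?\<phi> h - ?\<phi> 0 = h * (dif f ((x + h *\<^sub>R v) + s *\<^sub>R u) u - dif f (x + s *\<^sub>R u) u)"
    by auto
  let ?\<chi> = "\<lambda>t. dif f ((x + s *\<^sub>R u) + t *\<^sub>R v) u"
  have "(?\<chi> has_real_derivative dif (\<lambda>y. dif f y u) ((x + s *\<^sub>R u) + t *\<^sub>R v) v) (at t)"
    if "0 \<le> t" "t \<le> h" for t
    using that S[of s t] s
    by (intro smooth_on_line_derivative[OF smooth_on_dif[OF assms(1)]]) auto
  from MVT2[OF assms(2) this] obtain t where t: "0 < t" "t < h"
    "?\<chi> h - ?\<chi> 0 = h * dif (\<lambda>y. dif f y u) ((x + s *\<^sub>R u) + t *\<^sub>R v) v"
    by auto
  have "?\<phi> h - ?\<phi> 0 = h * (?\<chi> h - ?\<chi> 0)"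
    using s(3) by (simp add: algebra_simps)
  then show ?thesis
    using s(1,2) t by (intro exI[of _ s] exI[of _ t]) (simp add: algebra_simps)
qed

text \<open>The mixed difference is symmetric in \<open>u\<close> and \<open>v\<close>, so the two mixed derivatives agree at
  points arbitrarily close to \<open>x\<close>; by continuity they agree at \<open>x\<close>.\<close>

lemma symmetric_second_dif_real:
  fixes f :: "'a::real_normed_vector \<Rightarrow> real"
  assumes "open S" "smooth_on S f" "x \<in> S"
  shows "dif (\<lambda>y. dif f y u) x v = dif (\<lambda>y. dif f y v) x u"
proof (rule ccontr)
  let ?a = "\<lambda>y. dif (\<lambda>y. dif f y u) y v" and ?b = "\<lambda>y. dif (\<lambda>y. dif f y v) y u"
  assume ne: "?a x \<noteq> ?b x"
  have ab: "isCont ?a x" "isCont ?b x"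
    using continuous_on_eq_continuous_at[OF assms(1)] assms(3)
      smooth_on_imp_continuous_on[OF smooth_on_dif[OF smooth_on_dif[OF assms(2)]]] by blast+
  define e where "e = \<bar>?a x - ?b x\<bar> / 2"
  have "e > 0"
    using ne by (simp add: e_def)
  obtain d1 where d1: "d1 > 0" "\<And>y. dist y x < d1 \<Longrightarrow> \<bar>?a y - ?a x\<bar> < e"
    using ab(1) \<open>e > 0\<close> unfolding continuous_at_eps_delta dist_real_def by metis
  obtain d2 where d2: "d2 > 0" "\<And>y. dist y x < d2 \<Longrightarrow> \<bar>?b y - ?b x\<bar> < e"
    using ab(2) \<open>e > 0\<close> unfolding continuous_at_eps_delta dist_real_def by metis
  obtain d3 where d3: "d3 > 0" "\<And>y. dist y x < d3 \<Longrightarrow> y \<in> S"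
    using assms(1,3) unfolding open_dist by metis
  (* h is so small that the whole parallelogram spanned by h u and h v at x lies in the ball of
     radius d, where both mixed derivatives differ by less than e from their values at x *)
  define d where "d = min d1 (min d2 d3)"
  define h where "h = d / (norm u + norm v + 1)"
  have "d > 0"
    using d1 d2 d3 by (simp add: d_def)
  have np: "0 < norm u + norm v + 1"
    by (smt (verit) norm_ge_zero)
  then have "h > 0" and hd: "h * (norm u + norm v) < d"
    using \<open>d > 0\<close> by (auto simp: h_def field_simps)
  have near: "dist (x + s *\<^sub>R u + t *\<^sub>R v) x < d" if "0 \<le> s" "s \<le> h" "0 \<le> t" "t \<le> h" for s t
  proof -
    have "norm (s *\<^sub>R u + t *\<^sub>R v) \<le> s * norm u + t * norm v"
      using norm_triangle_ineq[of "s *\<^sub>R u" "t *\<^sub>R v"] that by simp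
    also have "\<dots> \<le> h * (norm u + norm v)"
      using that by (simp add: distrib_left add_mono mult_right_mono)
    finally show ?thesis
      using hd by (simp add: dist_norm add.assoc)
  qed
  have S: "x + s *\<^sub>R u + t *\<^sub>R v \<in> S" "x + s *\<^sub>R v + t *\<^sub>R u \<in> S"
    if "0 \<le> s" "s \<le> h" "0 \<le> t" "t \<le> h" for s t
    using near[of s t] near[of t s] that d3(2) by (auto simp: d_def algebra_simps)
  obtain s t where st: "0 < s" "s < h" "0 < t" "t < h"
    "f (x + h *\<^sub>R u + h *\<^sub>R v) - f (x + h *\<^sub>R u) - (f (x + h *\<^sub>R v) - f x)
      = h * (h * ?a (x + s *\<^sub>R u + t *\<^sub>R v))"
    using mixed_difference_mean_value[OF assms(2) \<open>h > 0\<close> S(1)] by blast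
  obtain s' t' where st': "0 < s'" "s' < h" "0 < t'" "t' < h"
    "f (x + h *\<^sub>R v + h *\<^sub>R u) - f (x + h *\<^sub>R v) - (f (x + h *\<^sub>R u) - f x)
      = h * (h * ?b (x + s' *\<^sub>R v + t' *\<^sub>R u))"
    using mixed_difference_mean_value[OF assms(2) \<open>h > 0\<close> S(2)] by blast
  have "x + h *\<^sub>R v + h *\<^sub>R u = x + h *\<^sub>R u + h *\<^sub>R v"
    by (simp add: algebra_simps)
  with st(5) st'(5) have "h * (h * ?a (x + s *\<^sub>R u + t *\<^sub>R v)) = h * (h * ?b (x + s' *\<^sub>R v + t' *\<^sub>R u))"
    by (smt (verit))
  then have "?a (x + s *\<^sub>R u + t *\<^sub>R v) = ?b (x + s' *\<^sub>R v + t' *\<^sub>R u)"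
    using \<open>h > 0\<close> by simp
  moreover have "\<bar>?a (x + s *\<^sub>R u + t *\<^sub>R v) - ?a x\<bar> < e"
    using near[of s t] st by (intro d1(2)) (simp add: d_def)
  moreover have "\<bar>?b (x + s' *\<^sub>R v + t' *\<^sub>R u) - ?b x\<bar> < e"
    using near[of t' s'] st' by (intro d2(2)) (simp add: d_def algebra_simps)
  ultimately show False
    unfolding e_def by (smt (verit, best) field_sum_of_halves)
qed

lemma symmetric_second_dif:
  fixes F :: "'a::real_normed_vector \<Rightarrow> 'b::euclidean_space"
  assumes "open S" "smooth_on S F" "x \<in> S"
  shows "dif (\<lambda>y. dif F y u) x v = dif (\<lambda>y. dif F y v) x u"
proof (rule euclidean_eqI)
  fix b :: 'b
  have inner: "dif (\<lambda>y. V y \<bullet> b) y w = dif V y w \<bullet> b" if "smooth_on S V" "y \<in> S" for V y w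
  proof -
    have "((\<lambda>y. V y \<bullet> b) has_derivative (\<lambda>w. dif V y w \<bullet> b)) (at y)"
      using smooth_on_has_derivative[OF that] by (rule has_derivative_inner_left)
    then show ?thesis by (simp add: dif_eqI)
  qed
  have "dif (\<lambda>y. dif F y u) x v \<bullet> b = dif (\<lambda>y. dif (\<lambda>y. F y \<bullet> b) y u) x v" for u v
  proof -
    have "(\<lambda>y. dif F y u \<bullet> b) differentiable (at x)"
      using smooth_on_differentiable[OF smooth_on_dif[OF assms(2)] assms(3)]
      by (intro differentiable_inner differentiable_const)
    then have "dif (\<lambda>y. dif F y u \<bullet> b) x = dif (\<lambda>y. dif (\<lambda>y. F y \<bullet> b) y u) x"
      by (rule dif_cong_open[OF assms(1,3)]) (simp add: inner[OF assms(2)])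
    then show ?thesis
      using inner[OF smooth_on_dif[OF assms(2)] assms(3)] by metis
  qed
  then show "dif (\<lambda>y. dif F y u) x v \<bullet> b = dif (\<lambda>y. dif F y v) x u \<bullet> b"
    using symmetric_second_dif_real[OF assms(1)
        smooth_on_bounded_linear[OF bounded_linear_inner_left assms(1,2)] assms(3)] by simp
qed


section \<open>Orthonormal bases for a Gram matrix\<close>

lemma minner_bilinear:
  "minner A (u + v) w = minner A u w + minner A v w"
  "minner A u (v + w) = minner A u v + minner A u w"
  "minner A (u - v) w = minner A u w - minner A v w"
  "minner A u (v - w) = minner A u v - minner A u w"
  "minner A (- u) v = - minner A u v"
  "minner A u (- v) = - minner A u v"
  "minner A (c *\<^sub>R u) v = c * minner A u v"
  "minner A u (c *\<^sub>R v) = c * minner A u v"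
  "minner A 0 v = 0"
  "minner A u 0 = 0"
  "minner A (\<Sum>i\<in>I. f i) v = (\<Sum>i\<in>I. minner A (f i) v)"
  "minner A u (\<Sum>i\<in>I. f i) = (\<Sum>i\<in>I. minner A u (f i))"
  unfolding minner_def
  by (auto simp: inner_add_left inner_add_right matrix_vector_right_distrib inner_diff_left
      inner_diff_right matrix_vector_mult_diff_distrib matrix_vector_mult_scaleR inner_sum_left
      inner_sum_right linear_sum[OF matrix_vector_mul_linear] linear_neg[OF matrix_vector_mul_linear])

lemma linear_minner_left: "linear (\<lambda>u. minner A u v)"
  and linear_minner_right: "linear (minner A u)"
  by (auto intro!: linearI simp: minner_bilinear)

lemma minner_matrix_add: "minner (A + B) u v = minner A u v + minner B u v"
  and minner_matrix_scaleR: "minner (c *\<^sub>R A) u v = c * minner A u v"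
  by (simp_all add: minner_def matrix_vector_mult_add_rdistrib inner_add_right
      scaleR_matrix_vector_assoc[symmetric])

definition metric_matrix :: "real^'n::finite^'n \<Rightarrow> bool" where
  "metric_matrix G \<longleftrightarrow>
     (\<forall>u v. minner G u v = minner G v u) \<and> (\<forall>u. u \<noteq> 0 \<longrightarrow> minner G u u > 0)"

lemma metric_matrix_commute: "metric_matrix G \<Longrightarrow> minner G u v = minner G v u"
  by (auto simp: metric_matrix_def)

lemma metric_matrix_pos: "metric_matrix G \<Longrightarrow> u \<noteq> 0 \<Longrightarrow> minner G u u > 0"
  by (auto simp: metric_matrix_def)

lemma metric_matrix_nonneg: "metric_matrix G \<Longrightarrow> minner G u u \<ge> 0"
  using metric_matrix_pos[of G u] by (cases "u = 0") (auto simp: minner_bilinear)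

lemma metric_matrix_eqI: "metric_matrix G \<Longrightarrow> (\<And>w. minner G u w = minner G v w) \<Longrightarrow> u = v"
  using metric_matrix_pos[of G "u - v"] by (auto simp: minner_bilinear)

lemma metric_matrix_invertible: "metric_matrix G \<Longrightarrow> invertible G"
  unfolding invertible_left_inverse matrix_left_invertible_ker
  by (metis inner_zero_right less_irrefl metric_matrix_pos minner_def)

definition orthonormal :: "real^'n::finite^'n \<Rightarrow> (real^'n) set \<Rightarrow> bool" where
  "orthonormal G E \<longleftrightarrow>
     finite E \<and> (\<forall>e\<in>E. \<forall>f\<in>E. minner G e f = (if e = f then 1 else 0))"

lemma orthonormal_sum:
  assumes "orthonormal G E" "f \<in> E"
  shows "(\<Sum>e\<in>E. c e * minner G e f) = c f"
proof -
  have "(\<Sum>e\<in>E. c e * minner G e f) = (\<Sum>e\<in>E. if e = f then c e else 0)"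
    using assms by (intro sum.cong) (auto simp: orthonormal_def)
  then show ?thesis
    using assms by (simp add: orthonormal_def)
qed

lemma orthonormal_card_le:
  fixes E :: "(real^'n::finite) set"
  assumes "orthonormal G E"
  shows "card E \<le> CARD('n)"
proof -
  have fin: "finite E"
    using assms by (simp add: orthonormal_def)
  have "independent E"
    unfolding dependent_finite[OF fin]
  proof clarify
    fix c f assume f: "f \<in> E" "c f \<noteq> 0" and "(\<Sum>e\<in>E. c e *\<^sub>R e) = 0"
    then have "minner G (\<Sum>e\<in>E. c e *\<^sub>R e) f = 0"
      by (simp add: minner_bilinear)
    then have "(\<Sum>e\<in>E. c e * minner G e f) = 0"
      by (simp add: minner_bilinear)
    with f show False
      using orthonormal_sum[OF assms f(1), of c] by simp
  qed
  then show ?thesis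
    using independent_bound[of E] by simp
qed

lemma orthonormal_extend:
  assumes "metric_matrix G" "orthonormal G E" "w \<noteq> 0" "\<And>e. e \<in> E \<Longrightarrow> minner G w e = 0"
  defines "f \<equiv> (1 / sqrt (minner G w w)) *\<^sub>R w"
  shows "orthonormal G (insert f E)" "card (insert f E) = Suc (card E)"
proof -
  have pos: "minner G w w > 0"
    using assms by (simp add: metric_matrix_pos)
  then have ff: "minner G f f = 1"
    by (simp add: f_def minner_bilinear)
  have fe: "minner G f e = 0" "minner G e f = 0" if "e \<in> E" for e
    using assms(1,4) that metric_matrix_commute[of G e w] by (auto simp: f_def minner_bilinear)
  from ff fe have "f \<notin> E" by force
  with ff fe assms(2) show "orthonormal G (insert f E)" "card (insert f E) = Suc (card E)"
    by (auto simp: orthonormal_def)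
qed

lemma orthonormal_remainder:
  assumes "orthonormal G E" "f \<in> E"
  shows "minner G (v - (\<Sum>e\<in>E. minner G v e *\<^sub>R e)) f = 0"
  using orthonormal_sum[OF assms, of "minner G v"] by (simp add: minner_bilinear)

lemma exists_orthonormal_basis:
  fixes G :: "real^'n::finite^'n"
  assumes "metric_matrix G"
  shows "\<exists>E. orthonormal G E \<and> card E = CARD('n)"
proof -
  have "\<exists>E. orthonormal G E \<and> card E = k" if "k \<le> CARD('n)" for k
    using that
  proof (induction k)
    case 0
    then show ?case
      by (intro exI[of _ "{}"]) (simp add: orthonormal_def)
  next
    case (Suc k)
    then obtain E where E: "orthonormal G E" "card E = k" by auto
    then have "finite E" by (simp add: orthonormal_def)
    have "dim (span E) \<le> k"
      using E \<open>finite E\<close> dim_le_card' by (metis dim_span)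
    moreover have "dim (UNIV :: (real^'n) set) = CARD('n)"
      by simp
    ultimately have "span E \<noteq> UNIV"
      using Suc.prems by (metis Suc_le_eq not_le)
    then obtain v where v: "v \<notin> span E" by auto
    define w where "w = v - (\<Sum>e\<in>E. minner G v e *\<^sub>R e)"
    have "(\<Sum>e\<in>E. minner G v e *\<^sub>R e) \<in> span E"
      by (intro span_sum span_scale span_base)
    with v have "w \<noteq> 0" by (auto simp: w_def)
    from orthonormal_extend[OF assms E(1) this orthonormal_remainder[OF E(1), of _ v, folded w_def]]
    show ?case
      using E(2) by blast
  qed
  then show ?thesis by blast
qed

text \<open>A nonzero remainder could be normalised and added to the basis, which would then be too
  large.\<close>

lemma orthonormal_expansion:
  fixes v :: "real^'n::finite"
  assumes "metric_matrix G" "orthonormal G E" "card E = CARD('n)"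
  shows "v = (\<Sum>e\<in>E. minner G v e *\<^sub>R e)"
proof (rule ccontr)
  let ?w = "v - (\<Sum>e\<in>E. minner G v e *\<^sub>R e)"
  assume "v \<noteq> (\<Sum>e\<in>E. minner G v e *\<^sub>R e)"
  then have "?w \<noteq> 0" by simp
  note extended = orthonormal_extend[OF assms(1,2) this orthonormal_remainder[OF assms(2)]]
  show False
    using orthonormal_card_le[OF extended(1)] extended(2) assms(3) by simp
qed

lemma orthonormal_parseval:
  fixes v w :: "real^'n::finite"
  assumes "metric_matrix G" "orthonormal G E" "card E = CARD('n)"
  shows "minner G v w = (\<Sum>e\<in>E. minner G v e * minner G w e)"
proof -
  have "minner G v w = minner G v (\<Sum>e\<in>E. minner G w e *\<^sub>R e)"
    using orthonormal_expansion[OF assms, of w] by simp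
  then show ?thesis
    by (simp add: minner_bilinear mult.commute)
qed

text \<open>If the vectors of an orthonormal basis are the columns of \<open>P\<close>, then \<open>P\<^sup>T G P\<close> is the
  identity, that is, the inverse of \<open>G\<close> is \<open>P P\<^sup>T\<close>.\<close>

lemma matrix_inv_orthonormal:
  fixes G :: "real^'n::finite^'n"
  assumes "metric_matrix G" "orthonormal G E" "card E = CARD('n)"
  shows "matrix_inv G $ i $ j = (\<Sum>e\<in>E. e $ i * e $ j)"
proof -
  let ?v = "matrix_inv G *v axis j 1"
  have "G *v ?v = axis j 1"
    using metric_matrix_invertible[OF assms(1)] by (simp add: matrix_vector_mul_assoc matrix_mul_matrix_inv)
  then have "minner G ?v e = e $ j" for e
    using metric_matrix_commute[OF assms(1), of ?v e] by (simp add: minner_def inner_axis)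
  then have "?v = (\<Sum>e\<in>E. e $ j *\<^sub>R e)"
    using orthonormal_expansion[OF assms, of ?v] by simp
  then have "?v $ i = (\<Sum>e\<in>E. e $ i * e $ j)"
    by (simp add: sum_component mult.commute)
  then show ?thesis
    by (simp add: matrix_vector_mult_basis column_def)
qed

lemma metric_trace_orthonormal:
  fixes G :: "real^'n::finite^'n"
  assumes "metric_matrix G" "orthonormal G E" "card E = CARD('n)"
    and "\<And>u. linear (B u)" "\<And>v. linear (\<lambda>u. B u v)"
  shows "metric_trace G B = (\<Sum>e\<in>E. B e e)"
proof -
  have "B e e = (\<Sum>i\<in>UNIV. \<Sum>j\<in>UNIV. (e $ i * e $ j) *\<^sub>R B (axis i 1) (axis j 1))" for e
  proof -
    have 1: "B u e = (\<Sum>i\<in>UNIV. u $ i *\<^sub>R B (axis i 1) e)" for u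
      by (rule linear_eq_sum_axis[OF assms(5)[of e], of u])
    have 2: "B u e = (\<Sum>j\<in>UNIV. e $ j *\<^sub>R B u (axis j 1))" for u
      by (rule linear_eq_sum_axis[OF assms(4)[of u], of e])
    have "B e e = (\<Sum>i\<in>UNIV. e $ i *\<^sub>R B (axis i 1) e)"
      by (rule 1)
    also have "\<dots> = (\<Sum>i\<in>UNIV. e $ i *\<^sub>R (\<Sum>j\<in>UNIV. e $ j *\<^sub>R B (axis i 1) (axis j 1)))"
      by (simp only: 2)
    finally show ?thesis
      by (simp add: scaleR_sum_right)
  qed
  then have "(\<Sum>e\<in>E. B e e) =
      (\<Sum>e\<in>E. \<Sum>i\<in>UNIV. \<Sum>j\<in>UNIV. (e $ i * e $ j) *\<^sub>R B (axis i 1) (axis j 1))"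
    by simp
  also have "\<dots> = (\<Sum>i\<in>UNIV. \<Sum>e\<in>E. \<Sum>j\<in>UNIV. (e $ i * e $ j) *\<^sub>R B (axis i 1) (axis j 1))"
    by (rule sum.swap)
  also have "\<dots> = (\<Sum>i\<in>UNIV. \<Sum>j\<in>UNIV. \<Sum>e\<in>E. (e $ i * e $ j) *\<^sub>R B (axis i 1) (axis j 1))"
    by (intro sum.cong refl sum.swap)
  finally show ?thesis
    by (simp add: metric_trace_def matrix_inv_orthonormal[OF assms(1-3)] scaleR_sum_left)
qed

lemma linear_metric_trace: "linear f \<Longrightarrow> f (metric_trace G B) = metric_trace G (\<lambda>u v. f (B u v))"
  by (simp add: metric_trace_def linear_sum linear_cmul)

text \<open>In an orthonormal basis the trace is a sum of squared norms.\<close>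

lemma metric_trace_nonneg:
  assumes "metric_matrix G" "metric_matrix K" "linear L"
  shows "metric_trace G (\<lambda>u v. minner K (L u) (L v)) \<ge> 0"
proof -
  obtain E where E: "orthonormal G E" "card E = CARD('a)"
    using exists_orthonormal_basis[OF assms(1)] by blast
  have "metric_trace G (\<lambda>u v. minner K (L u) (L v)) = (\<Sum>e\<in>E. minner K (L e) (L e))"
    using linear_compose[OF assms(3) linear_minner_left, of K]
      linear_compose[OF assms(3) linear_minner_right, of K]
    by (intro metric_trace_orthonormal[OF assms(1) E]) (auto simp: o_def)
  then show ?thesis
    using metric_matrix_nonneg[OF assms(2)] by (simp add: sum_nonneg)
qed

lemma trace_orthonormal:
  fixes G :: "real^'n::finite^'n"
  assumes "metric_matrix G" "orthonormal G E" "card E = CARD('n)" "linear L"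
  shows "trace (matrix L) = (\<Sum>e\<in>E. minner G (L e) e)"
proof -
  have "L (axis i 1) = (\<Sum>e\<in>E. (G *v e) $ i *\<^sub>R L e)" for i
  proof -
    have "axis i 1 = (\<Sum>e\<in>E. (G *v e) $ i *\<^sub>R e)"
      using orthonormal_expansion[OF assms(1-3), of "axis i 1"]
      by (simp add: minner_def inner_axis' cong: sum.cong)
    then show ?thesis
      using linear_sum[OF assms(4), of "\<lambda>e. (G *v e) $ i *\<^sub>R e" E] linear_cmul[OF assms(4)] by simp
  qed
  then have "trace (matrix L) = (\<Sum>i\<in>UNIV. \<Sum>e\<in>E. (G *v e) $ i * L e $ i)"
    by (simp add: trace_def matrix_def sum_component)
  also have "\<dots> = (\<Sum>e\<in>E. minner G (L e) e)"
    by (subst sum.swap) (simp add: minner_def inner_vec_def mult.commute)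
  finally show ?thesis .
qed


section \<open>The Levi-Civita connection in a chart\<close>

lemma bounded_bilinear_matrix_vector_mult:
  "bounded_bilinear (\<lambda>(A :: real^'n::finite^'m::finite) v. A *v v)"
  unfolding bilinear_conv_bounded_bilinear[symmetric] bilinear_def
  by (auto intro!: linearI simp: matrix_vector_right_distrib matrix_vector_mult_add_rdistrib
      matrix_vector_mult_scaleR scaleR_matrix_vector_assoc[symmetric])

lemma minner_has_derivative:
  assumes "(A has_derivative A') (at x)" "(V has_derivative V') (at x)"
    "(W has_derivative W') (at x)"
  shows "((\<lambda>y. minner (A y) (V y) (W y)) has_derivative
    (\<lambda>u. minner (A' u) (V x) (W x) + minner (A x) (V' u) (W x) + minner (A x) (V x) (W' u)))
    (at x)"
  unfolding minner_def
  by (rule has_derivative_eq_rhs[OF has_derivative_inner[OF assms(2)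
          bounded_bilinear.FDERIV[OF bounded_bilinear_matrix_vector_mult assms(1,3)]]])
    (auto simp: inner_add_right)

locale metric_chart =
  fixes S :: "(real^'n::finite) set" and G :: "'n matrix_field"
  assumes open_dom: "open S"
    and smooth_metric: "smooth_on S G"
    and metric: "x \<in> S \<Longrightarrow> metric_matrix (G x)"
begin

lemma dif_metric: "x \<in> S \<Longrightarrow> dif (\<lambda>y. minner (G y) v w) x u = minner (dif G x u) v w"
  using minner_has_derivative[OF smooth_on_has_derivative[OF smooth_metric]
      has_derivative_const has_derivative_const]
  by (subst dif_eqI) (auto simp: minner_bilinear)

lemma linear_dif_metric: "x \<in> S \<Longrightarrow> linear (\<lambda>u. minner (dif G x u) v w)"
  using smooth_on_linear_dif[OF smooth_metric]
  by (auto intro!: linearI simp: linear_add linear_cmul minner_matrix_add minner_matrix_scaleR)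

lemma dif_metric_commute:
  assumes "x \<in> S"
  shows "minner (dif G x u) v w = minner (dif G x u) w v"
proof -
  have "dif (\<lambda>y. minner (G y) v w) x = dif (\<lambda>y. minner (G y) w v) x"
  proof (rule dif_cong_open[OF open_dom assms])
    show "(\<lambda>y. minner (G y) v w) differentiable (at x)"
      using minner_has_derivative[OF smooth_on_has_derivative[OF smooth_metric assms]
          has_derivative_const has_derivative_const]
      unfolding differentiable_def by blast
  qed (use metric metric_matrix_commute in blast)
  then show ?thesis
    using dif_metric[OF assms] by metis
qed

text \<open>The vector on the right consists of the Christoffel symbols of the first kind, contracted with
  \<open>u\<close> and \<open>v\<close>.\<close>

lemma christoffel_eq:
  assumes "x \<in> S"
  shows "christoffel G x u v = (1/2) *\<^sub>R (matrix_inv (G x) *v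
    (\<chi> l. minner (dif G x u) v (axis l 1) + minner (dif G x v) u (axis l 1)
       - minner (dif G x (axis l 1)) u v))"
proof -
  have pd: "pd i (\<lambda>y. G y $ j $ l) x = dif G x (axis i 1) $ j $ l" for i j l
  proof -
    have "((\<lambda>y. G y $ j $ l) has_derivative (\<lambda>u. dif G x u $ j $ l)) (at x)"
      using smooth_on_has_derivative[OF smooth_metric assms]
      by (intro bounded_linear.has_derivative[OF bounded_linear_vec_nth])
    then show ?thesis
      by (simp add: pd_def dif_eqI)
  qed
  have entries: "minner A v w = (\<Sum>i\<in>UNIV. \<Sum>j\<in>UNIV. A $ i $ j * v $ i * w $ j)"
    for A :: "real^'n^'n" and v w
    by (simp add: minner_def inner_vec_def matrix_vector_mult_def sum_distrib_left mult_ac)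
  have row: "minner A v (axis l 1) = (\<Sum>j\<in>UNIV. A $ j $ l * v $ j)" for A :: "real^'n^'n" and v l
    by (simp add: minner_def inner_vec_def matrix_vector_mult_basis column_def mult_ac)
  have dif: "minner (dif G x u) v w = (\<Sum>i\<in>UNIV. u $ i * minner (dif G x (axis i 1)) v w)"
    for u v w
    unfolding real_scaleR_def[symmetric]
    by (rule linear_eq_sum_axis[OF linear_dif_metric[OF assms, of v w], of u])
  have 1: "(\<Sum>i\<in>UNIV. \<Sum>j\<in>UNIV. dif G x (axis i 1) $ j $ l * u $ i * v $ j)
      = minner (dif G x u) v (axis l 1)" for u v l
    by (subst dif[of u]) (simp only: row sum_distrib_left mult_ac)
  have 2: "(\<Sum>i\<in>UNIV. \<Sum>j\<in>UNIV. dif G x (axis j 1) $ i $ l * u $ i * v $ j)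
      = minner (dif G x v) u (axis l 1)" for l
    unfolding 1[symmetric]
    by (subst sum.swap) (intro sum.cong refl, simp only: mult_ac)
  have 3: "(\<Sum>i\<in>UNIV. \<Sum>j\<in>UNIV. dif G x (axis l 1) $ i $ j * u $ i * v $ j)
      = minner (dif G x (axis l 1)) u v" for l
    by (simp only: entries)
  let ?K = "\<lambda>i j l. dif G x (axis i 1) $ j $ l * u $ i * v $ j
    + dif G x (axis j 1) $ i $ l * u $ i * v $ j - dif G x (axis l 1) $ i $ j * u $ i * v $ j"
  have K: "(\<Sum>i\<in>UNIV. \<Sum>j\<in>UNIV. ?K i j l) = minner (dif G x u) v (axis l 1)
      + minner (dif G x v) u (axis l 1) - minner (dif G x (axis l 1)) u v" for l
    by (simp only: sum.distrib sum_subtractf 1 2 3)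
  have "(\<Sum>i\<in>UNIV. \<Sum>j\<in>UNIV. christoffel_symbol G x k i j * u $ i * v $ j)
      = 1/2 * (\<Sum>l\<in>UNIV. matrix_inv (G x) $ k $ l * (\<Sum>i\<in>UNIV. \<Sum>j\<in>UNIV. ?K i j l))" for k
  proof -
    let ?t = "\<lambda>i j l. 1/2 * (matrix_inv (G x) $ k $ l * ?K i j l)"
    have "(\<Sum>i\<in>UNIV. \<Sum>j\<in>UNIV. christoffel_symbol G x k i j * u $ i * v $ j)
        = (\<Sum>i\<in>UNIV. \<Sum>j\<in>UNIV. \<Sum>l\<in>UNIV. ?t i j l)"
      unfolding christoffel_symbol_def pd sum_distrib_left sum_distrib_right
      by (intro sum.cong refl) (simp add: algebra_simps)
    also have "\<dots> = (\<Sum>i\<in>UNIV. \<Sum>l\<in>UNIV. \<Sum>j\<in>UNIV. ?t i j l)"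
      by (intro sum.cong refl sum.swap)
    also have "\<dots> = (\<Sum>l\<in>UNIV. \<Sum>i\<in>UNIV. \<Sum>j\<in>UNIV. ?t i j l)"
      by (rule sum.swap)
    finally show ?thesis
      by (simp only: sum_distrib_left)
  qed
  then show ?thesis
    by (simp add: christoffel_def vec_eq_iff matrix_vector_mult_def K)
qed

text \<open>Pairing with \<open>G\<close> cancels the inverse matrix in the Christoffel symbols.\<close>

lemma koszul:
  assumes "x \<in> S"
  shows "2 * minner (G x) (christoffel G x u v) w =
    minner (dif G x u) v w + minner (dif G x v) u w - minner (dif G x w) u v"
proof -
  let ?k = "\<lambda>w. minner (dif G x u) v w + minner (dif G x v) u w - minner (dif G x w) u v"
  have "linear ?k"
    by (intro linear_compose_add linear_compose_sub linear_minner_right linear_dif_metric assms)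
  have "G x *v (matrix_inv (G x) *v z) = z" for z
    using metric_matrix_invertible[OF metric[OF assms]]
    by (simp add: matrix_vector_mul_assoc matrix_mul_matrix_inv)
  then have "2 *\<^sub>R (G x *v christoffel G x u v) = (\<chi> l. ?k (axis l 1))"
    by (simp add: christoffel_eq[OF assms] matrix_vector_mult_scaleR)
  then have "2 * (w \<bullet> (G x *v christoffel G x u v)) = w \<bullet> (\<chi> l. ?k (axis l 1))"
    by (metis inner_scaleR_right)
  also have "\<dots> = ?k w"
    unfolding inner_vec_def by (subst linear_eq_sum_axis[OF \<open>linear ?k\<close>, of w]) simp
  finally show ?thesis
    using metric_matrix_commute[OF metric[OF assms], of w] by (simp add: minner_def)
qed

lemma christoffel_commute:
  assumes "x \<in> S"
  shows "christoffel G x u v = christoffel G x v u"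
proof (rule metric_matrix_eqI[OF metric[OF assms]])
  show "minner (G x) (christoffel G x u v) w = minner (G x) (christoffel G x v u) w" for w
    using koszul[OF assms, of u v w] koszul[OF assms, of v u w] dif_metric_commute[OF assms, of w u v]
    by linarith
qed

text \<open>In the sum of the Koszul formulas for \<open>(z, v, w)\<close> and \<open>(z, w, v)\<close> the derivatives in the
  directions \<open>v\<close> and \<open>w\<close> cancel.\<close>

lemma metric_compatible:
  assumes "x \<in> S"
  shows "minner (dif G x z) v w =
    minner (G x) (christoffel G x z v) w + minner (G x) v (christoffel G x z w)"
  using koszul[OF assms, of z v w] koszul[OF assms, of z w v]
    dif_metric_commute[OF assms, of z w v] dif_metric_commute[OF assms, of v z w]
    dif_metric_commute[OF assms, of w z v]
    metric_matrix_commute[OF metric[OF assms], of v "christoffel G x z w"]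
  by linarith

lemma linear_christoffel_left: "linear (\<lambda>u. christoffel G x u v)"
  by (auto intro!: linearI simp: christoffel_def vec_eq_iff sum_distrib_left sum.distrib
      algebra_simps)

lemma smooth_christoffel_symbol: "smooth_on S (\<lambda>x. christoffel_symbol G x k i j)"
proof -
  have "smooth_on S (\<lambda>x. pd i (\<lambda>y. G y $ j $ l) x)" for i j l
    unfolding pd_def by (intro smooth_on_dif smooth_on_vec_nth open_dom smooth_metric)
  then show ?thesis
    unfolding christoffel_symbol_def
    by (intro smooth_on_mult smooth_on_sum smooth_on_add smooth_on_diff smooth_on_const open_dom
        smooth_on_matrix_inv smooth_metric metric_matrix_invertible metric)
qed

end


section \<open>Isometric immersions in a pair of charts\<close>

locale isometric_immersion_chart =
  source: metric_chart S G + target: metric_chart T H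
  for S :: "(real^'m::finite) set" and G and T :: "(real^'n::finite) set" and H +
  fixes F :: "real^'m \<Rightarrow> real^'n"
  assumes smooth_rep: "smooth_on S F"
    and rep_in: "x \<in> S \<Longrightarrow> F x \<in> T"
    and isometric: "x \<in> S \<Longrightarrow> minner (H (F x)) (dif F x u) (dif F x v) = minner (G x) u v"
begin

lemma linear_dif_rep: "x \<in> S \<Longrightarrow> linear (dif F x)"
  using smooth_rep by (rule smooth_on_linear_dif)

lemma smooth_christoffel_pullback:
  assumes "smooth_on S U" "smooth_on S V"
  shows "smooth_on S (\<lambda>x. christoffel H (F x) (U x) (V x))"
proof -
  have "smooth_on S (\<lambda>x. christoffel_symbol H (F x) k i j)" for k i j
    using rep_in
    by (intro smooth_on_compose[OF source.open_dom target.smooth_christoffel_symbol smooth_rep]) auto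
  then show ?thesis
    unfolding christoffel_def
    by (intro smooth_on_vec_lambda smooth_on_sum smooth_on_mult smooth_on_vec_nth assms
        source.open_dom)
qed

lemma smooth_pullback_covd: "smooth_on S V \<Longrightarrow> smooth_on S (pullback_covd H F (\<lambda>_. u) V)"
  unfolding pullback_covd_def
  by (intro smooth_on_add source.open_dom smooth_on_dif smooth_christoffel_pullback smooth_rep)

lemma linear_pullback_covd:
  assumes "smooth_on S V" "x \<in> S"
  shows "linear (\<lambda>u. pullback_covd H F (\<lambda>_. u) V x)"
  unfolding pullback_covd_def
  using linear_compose[OF linear_dif_rep[OF assms(2)] target.linear_christoffel_left]
  by (intro linear_compose_add smooth_on_linear_dif[OF assms]) (simp add: o_def)

text \<open>The pullback connection inherits compatibility with the metric by the chain rule.\<close>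

lemma pullback_metric_derivative:
  assumes "smooth_on S V" "smooth_on S W" "x \<in> S"
  shows "((\<lambda>y. minner (H (F y)) (V y) (W y)) has_derivative
    (\<lambda>u. minner (H (F x)) (pullback_covd H F (\<lambda>_. u) V x) (W x)
       + minner (H (F x)) (V x) (pullback_covd H F (\<lambda>_. u) W x))) (at x)"
proof -
  have "((\<lambda>y. H (F y)) has_derivative (\<lambda>u. dif H (F x) (dif F x u))) (at x)"
    using diff_chain_at[OF smooth_on_has_derivative[OF smooth_rep assms(3)]
        smooth_on_has_derivative[OF target.smooth_metric rep_in[OF assms(3)]]]
    by (simp add: o_def)
  from minner_has_derivative[OF this smooth_on_has_derivative[OF assms(1,3)]
      smooth_on_has_derivative[OF assms(2,3)]]
  show ?thesis
    by (rule has_derivative_eq_rhs) (auto simp: pullback_covd_def minner_bilinear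
        target.metric_compatible[OF rep_in[OF assms(3)]])
qed

text \<open>\<open>N u v w = \<langle>\<nabla>\<^sub>u dF v, dF w\<rangle>\<close> is symmetric in \<open>u\<close> and \<open>v\<close>, and differentiating the isometry
  condition expresses the derivatives of \<open>G\<close> by \<open>N\<close>. These are the two properties from which the
  Koszul formula is derived, so \<open>N u v w = \<langle>\<Gamma>(u, v), w\<rangle>\<close> with the Christoffel symbols of \<open>G\<close>.\<close>

lemma second_fundamental_form_normal:
  assumes x: "x \<in> S"
  shows "minner (H (F x)) (second_fundamental_form G H F x u v) (dif F x w) = 0"
proof -
  define N where
    "N u v w = minner (H (F x)) (pullback_covd H F (\<lambda>_. u) (\<lambda>y. dif F y v) x) (dif F x w)" for u v w
  have sym: "N u v w = N v u w" for u v w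
    unfolding N_def pullback_covd_def
    using symmetric_second_dif[OF source.open_dom smooth_rep x, of u v]
      target.christoffel_commute[OF rep_in[OF x], of "dif F x u" "dif F x v"] by simp
  have dG: "minner (dif G x u) v w = N u v w + N u w v" for u v w
  proof -
    have "((\<lambda>y. minner (H (F y)) (dif F y v) (dif F y w)) has_derivative
        (\<lambda>u. N u v w + N u w v)) (at x)"
      using pullback_metric_derivative[OF smooth_on_dif[OF smooth_rep] smooth_on_dif[OF smooth_rep]
          x, of v w]
      by (rule has_derivative_eq_rhs)
        (auto simp: N_def metric_matrix_commute[OF target.metric[OF rep_in[OF x]], of "dif F x v"])
    then have "((\<lambda>y. minner (G y) v w) has_derivative (\<lambda>u. N u v w + N u w v)) (at x)"
      by (rule has_derivative_transform_within_open[OF _ source.open_dom x]) (simp add: isometric)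
    then show ?thesis
      using source.dif_metric[OF x, of v w u] by (simp add: dif_eqI)
  qed
  have "2 * minner (G x) (christoffel G x u v) w = 2 * N u v w"
    unfolding source.koszul[OF x] dG using sym[of u w v] sym[of v w u] sym[of u v w] by linarith
  moreover have "covd G (\<lambda>_. u) (\<lambda>_. v) x = christoffel G x u v"
    by (simp add: covd_def)
  ultimately show ?thesis
    by (simp add: second_fundamental_form_def minner_bilinear isometric[OF x] N_def[symmetric])
qed

lemma tension_normal:
  assumes "x \<in> S"
  shows "minner (H (F x)) (tension G H F x) (dif F x w) = 0"
  unfolding tension_def linear_metric_trace[OF linear_minner_left]
  by (simp add: second_fundamental_form_normal[OF assms] metric_trace_def)

lemma smooth_tension: "smooth_on S (tension G H F)"
proof -
  have "smooth_on S (\<lambda>x. covd G (\<lambda>_. u) (\<lambda>_. v) x)" for u v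
    unfolding covd_def christoffel_def
    by (intro smooth_on_add smooth_on_dif smooth_on_vec_lambda smooth_on_sum smooth_on_mult
        smooth_on_const source.open_dom source.smooth_christoffel_symbol)
  then have "smooth_on S (\<lambda>x. second_fundamental_form G H F x u v)" for u v
    unfolding second_fundamental_form_def
    by (intro smooth_on_diff smooth_pullback_covd smooth_on_dif smooth_on_dif_apply smooth_rep
        source.open_dom)
  then have "smooth_on S (\<lambda>x. tension G H F x)"
    unfolding tension_def metric_trace_def
    by (intro smooth_on_sum smooth_on_scaleR source.open_dom smooth_on_matrix_inv
        source.smooth_metric metric_matrix_invertible source.metric)
  then show ?thesis .
qed

text \<open>A section of constant norm is orthogonal to its covariant derivatives.
  Differentiating \<open>\<langle>\<nabla>\<^sub>v V, V\<rangle> = 0\<close>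
  once more gives \<open>\<langle>\<nabla>\<^sup>2V(u, v), V\<rangle> = -\<langle>\<nabla>\<^sub>v V, \<nabla>\<^sub>u V\<rangle>\<close>; the trace of the right-hand side is
  minus the squared norm of \<open>\<nabla>V\<close>.\<close>

lemma rough_laplacian_constant_norm:
  assumes V: "smooth_on S V" and norm: "\<And>y. y \<in> S \<Longrightarrow> minner (H (F y)) (V y) (V y) = c"
    and x: "x \<in> S"
  shows "minner (H (F x)) (rough_laplacian G H F V x) (V x) \<le> 0"
proof -
  let ?D = "\<lambda>v. pullback_covd H F (\<lambda>_. v) V"
  have const_zero: "f' = (\<lambda>_. 0)"
    if "(f has_derivative f') (at y)" "y \<in> S" "\<And>z. z \<in> S \<Longrightarrow> f z = b" for f f' y and b :: real
    using has_derivative_transform_within_open[OF that(1) source.open_dom that(2,3)]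
      has_derivative_const has_derivative_unique by blast
  have orth: "minner (H (F y)) (?D v y) (V y) = 0" if "y \<in> S" for v y
    using fun_cong[OF const_zero[OF pullback_metric_derivative[OF V V that] that norm], of v]
      metric_matrix_commute[OF target.metric[OF rep_in[OF that]], of "V y"] by simp
  have hess: "minner (H (F x)) (second_covd G H F V x u v) (V x)
      = - minner (H (F x)) (?D u x) (?D v x)" for u v
  proof -
    have "minner (H (F x)) (pullback_covd H F (\<lambda>_. u) (?D v) x) (V x)
        + minner (H (F x)) (?D v x) (?D u x) = 0"
      using fun_cong[OF const_zero[OF pullback_metric_derivative[OF smooth_pullback_covd[OF V] V x]
            x orth], of u] by simp
    moreover have "minner (H (F x)) (pullback_covd H F (covd G (\<lambda>_. u) (\<lambda>_. v)) V x) (V x) = 0"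
      using orth[OF x, of "covd G (\<lambda>_. u) (\<lambda>_. v) x"] by (simp add: pullback_covd_def)
    ultimately show ?thesis
      using metric_matrix_commute[OF target.metric[OF rep_in[OF x]], of "?D u x" "?D v x"]
      by (simp add: second_covd_def minner_bilinear)
  qed
  have "minner (H (F x)) (rough_laplacian G H F V x) (V x)
      = - metric_trace (G x) (\<lambda>u v. minner (H (F x)) (?D u x) (?D v x))"
    unfolding rough_laplacian_def linear_metric_trace[OF linear_minner_left] hess
    by (simp add: metric_trace_def sum_negf)
  also have "\<dots> \<le> 0"
    using metric_trace_nonneg[OF source.metric[OF x] target.metric[OF rep_in[OF x]]
        linear_pullback_covd[OF V x]] by simp
  finally show ?thesis .
qed

end


section \<open>The curvature of a generalized complex space form\<close>

definition space_form_curvature ::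
  "real^'n^'n \<Rightarrow> real^'n^'n \<Rightarrow> real \<Rightarrow> real \<Rightarrow> real^'n::finite \<Rightarrow> real^'n \<Rightarrow> real^'n \<Rightarrow> real^'n" where
  "space_form_curvature K J a b u v w = a *\<^sub>R curv_R1 K u v w + b *\<^sub>R curv_R2 K J u v w"

locale hermitian_inner_product =
  fixes K J :: "real^'n::finite^'n"
  assumes metric: "metric_matrix K"
    and square: "J *v (J *v u) = - u"
    and orthogonal: "minner K (J *v u) (J *v v) = minner K u v"
begin

abbreviation "R \<equiv> space_form_curvature K J"

lemma skew: "minner K (J *v u) v = - minner K u (J *v v)"
  using orthogonal[of "J *v u" v] by (simp add: square minner_bilinear)

lemma skew_self: "minner K (J *v u) u = 0"
  using skew[of u u] metric_matrix_commute[OF metric, of u] by simp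

lemma linear_R: "linear (\<lambda>u. R a b u v w)" "linear (R a b u v)"
  by (auto intro!: linearI simp: space_form_curvature_def curv_R1_def curv_R2_def minner_bilinear
      matrix_vector_right_distrib matrix_vector_mult_scaleR algebra_simps)

text \<open>The Ricci tensor is a multiple of the metric: the terms with \<open>J\<close> contribute
  \<open>\<langle>Jv, Jw\<rangle> = \<langle>v, w\<rangle>\<close> three times, and \<open>J\<close> itself has trace zero since \<open>\<langle>Je, e\<rangle> = 0\<close>.\<close>

lemma trace_R: "trace (matrix (\<lambda>u. R a b u v w)) = ((real CARD('n) - 1) * a + 3 * b) * minner K v w"
proof -
  obtain E where E: "orthonormal K E" "card E = CARD('n)"
    using exists_orthonormal_basis[OF metric] by blast
  have "minner K (R a b e v w) e = a * (minner K v w - minner K v e * minner K w e)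
      + b * (3 * (minner K (J *v v) e * minner K (J *v w) e))" if "e \<in> E" for e
  proof -
    have "minner K e e = 1"
      using E that by (simp add: orthonormal_def)
    then show ?thesis
      using skew[of e w] skew_self[of e] metric_matrix_commute[OF metric, of e w]
        metric_matrix_commute[OF metric, of e "J *v w"]
      by (simp add: space_form_curvature_def curv_R1_def curv_R2_def minner_bilinear algebra_simps)
  qed
  then have "trace (matrix (\<lambda>u. R a b u v w))
      = (\<Sum>e\<in>E. a * (minner K v w - minner K v e * minner K w e)
        + b * (3 * (minner K (J *v v) e * minner K (J *v w) e)))"
    unfolding trace_orthonormal[OF metric E linear_R(1)] by (intro sum.cong refl)
  also have "\<dots> = a * (real CARD('n) * minner K v w - minner K v w)
      + b * (3 * minner K (J *v v) (J *v w))"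
    by (simp add: sum.distrib sum_subtractf sum_distrib_left[symmetric] E(2)
        orthonormal_parseval[OF metric E, symmetric])
  finally show ?thesis
    by (simp add: orthogonal algebra_simps)
qed

text \<open>The vector \<open>J\<nu>\<close> is orthogonal to \<open>\<nu>\<close>, so in codimension one it is tangent, and its full norm
  is seen by a tangent orthonormal basis.\<close>

lemma trace_R_hypersurface:
  fixes L :: "real^'m::finite \<Rightarrow> real^'n"
  assumes G: "metric_matrix G" and L: "linear L" "\<And>u v. minner K (L u) (L v) = minner G u v"
    and codim: "CARD('n) = Suc CARD('m)" and normal: "\<And>u. minner K \<nu> (L u) = 0"
  shows "minner K (metric_trace G (\<lambda>u v. R a b (L u) \<nu> (L v))) \<nu>
    = - (real CARD('m) * a + 3 * b) * minner K \<nu> \<nu>"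
proof (cases "\<nu> = 0")
  case False
  obtain E where E: "orthonormal G E" "card E = CARD('m)"
    using exists_orthonormal_basis[OF G] by blast
  have unit: "minner G e e = 1" if "e \<in> E" for e
    using E that by (simp add: orthonormal_def)
  have inj: "inj_on L E"
  proof (rule inj_onI)
    fix e f assume ef: "e \<in> E" "f \<in> E" "L e = L f"
    then have "minner G e f = 1"
      using L(2)[of e f] L(2)[of e e] unit by simp
    with ef show "e = f"
      using E(1) by (auto simp: orthonormal_def split: if_splits)
  qed
  have LE: "orthonormal K (L ` E)"
    using E(1) inj by (auto simp: orthonormal_def L(2) inj_on_eq_iff)
  (* the unit normal completes the image of the tangent basis to a basis of the ambient space *)
  define f where "f = (1 / sqrt (minner K \<nu> \<nu>)) *\<^sub>R \<nu>"
  have ext: "orthonormal K (insert f (L ` E))" "card (insert f (L ` E)) = Suc (card (L ` E))"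
    using orthonormal_extend[OF metric LE False] normal by (auto simp: f_def)
  then have card: "card (insert f (L ` E)) = CARD('n)"
    using E(2) codim by (simp add: card_image[OF inj])
  have "minner K (J *v \<nu>) f = 0"
    by (simp add: f_def minner_bilinear skew_self)
  moreover have "finite (L ` E)" "f \<notin> L ` E"
    using ext LE by (auto simp: orthonormal_def insert_absorb)
  ultimately have "minner K (J *v \<nu>) (J *v \<nu>)
      = (\<Sum>e\<in>L ` E. minner K (J *v \<nu>) e * minner K (J *v \<nu>) e)"
    using orthonormal_parseval[OF metric ext(1) card, of "J *v \<nu>" "J *v \<nu>"] by simp
  then have parseval: "minner K \<nu> \<nu> = (\<Sum>e\<in>E. minner K (J *v \<nu>) (L e) * minner K (J *v \<nu>) (L e))"
    by (simp add: orthogonal sum.reindex[OF inj] o_def)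
  have entry: "minner K (R a b (L e) \<nu> (L e)) \<nu>
      = - a * minner K \<nu> \<nu> - 3 * b * (minner K (J *v \<nu>) (L e) * minner K (J *v \<nu>) (L e))"
    if "e \<in> E" for e
    using normal[of e] skew[of "L e" \<nu>] skew_self[of \<nu>] L(2)[of e e] unit[OF that]
      metric_matrix_commute[OF metric, of "L e" "J *v \<nu>"]
    by (simp add: space_form_curvature_def curv_R1_def curv_R2_def minner_bilinear algebra_simps)
  have "minner K (metric_trace G (\<lambda>u v. R a b (L u) \<nu> (L v))) \<nu>
      = metric_trace G (\<lambda>u v. minner K (R a b (L u) \<nu> (L v)) \<nu>)"
    by (rule linear_metric_trace[OF linear_minner_left])
  also have "\<dots> = (\<Sum>e\<in>E. minner K (R a b (L e) \<nu> (L e)) \<nu>)"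
    using linear_compose[OF linear_compose[OF L(1) linear_R(1)] linear_minner_left]
      linear_compose[OF linear_compose[OF L(1) linear_R(2)] linear_minner_left]
    by (intro metric_trace_orthonormal[OF G E]) (auto simp: o_def)
  also have "\<dots> = (\<Sum>e\<in>E. - a * minner K \<nu> \<nu>
      - 3 * b * (minner K (J *v \<nu>) (L e) * minner K (J *v \<nu>) (L e)))"
    by (intro sum.cong refl entry)
  also have "\<dots> = - (real CARD('m) * a) * minner K \<nu> \<nu> - 3 * b * minner K \<nu> \<nu>"
    by (simp add: sum_subtractf sum_distrib_left[symmetric] E(2) parseval[symmetric])
  finally show ?thesis
    by (simp add: algebra_simps)
qed (simp add: minner_bilinear)

end


section \<open>From manifolds to charts\<close>

lemma riemannian_metric_chart:
  assumes "riemannian_manifold A g" "c \<in> A" "open S" "S \<subseteq> cimg c"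
  shows "metric_chart S (g c)"
proof
  show "smooth_on S (g c)"
    using assms smooth_on_subset unfolding riemannian_manifold_def by blast
  show "metric_matrix (g c x)" if "x \<in> S" for x
    using assms that unfolding riemannian_manifold_def metric_matrix_def by blast
qed (fact assms(3))

lemma open_cimg: "riemannian_manifold A g \<Longrightarrow> c \<in> A \<Longrightarrow> open (cimg c)"
  by (simp add: riemannian_manifold_def smooth_atlas_def)

lemma chart_homeomorphism:
  "riemannian_manifold A g \<Longrightarrow> c \<in> A \<Longrightarrow> homeomorphism (cdom c) (cimg c) (cmap c) (cinv c)"
  by (simp add: riemannian_manifold_def smooth_atlas_def)

lemma isometric_immersion_in_charts:
  assumes imm: "isometric_immersion A g B h \<psi>" and c: "c \<in> A" and d: "d \<in> B"
  shows "isometric_immersion_chart (rep_dom c d \<psi>) (g c) (cimg d) (h d) (local_rep c d \<psi>)"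
proof -
  have A: "riemannian_manifold A g" and B: "riemannian_manifold B h" and \<psi>: "smooth_map A B \<psi>"
    using imm by (auto simp: isometric_immersion_def)
  have hom: "homeomorphism (cdom c) (cimg c) (cmap c) (cinv c)"
    using chart_homeomorphism[OF A c] .
  have "open (cdom d)" "open (cdom c)"
    using A B c d by (auto simp: riemannian_manifold_def smooth_atlas_def)
  moreover have "continuous_on UNIV \<psi>"
    using \<psi> by (simp add: smooth_map_def)
  ultimately have "openin (top_of_set (cdom c)) (cdom c \<inter> \<psi> -` cdom d)"
    by (auto intro: open_vimage simp: openin_open)
  then have "openin (top_of_set (cimg c)) (rep_dom c d \<psi>)"
    unfolding rep_dom_def by (rule homeomorphism_imp_open_map[OF hom])
  then have op: "open (rep_dom c d \<psi>)" and sub: "rep_dom c d \<psi> \<subseteq> cimg c"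
    using open_cimg[OF A c] by (auto simp: openin_open_eq)
  interpret source: metric_chart "rep_dom c d \<psi>" "g c"
    using riemannian_metric_chart[OF A c op sub] .
  interpret target: metric_chart "cimg d" "h d"
    using riemannian_metric_chart[OF B d open_cimg[OF B d] subset_refl] .
  show ?thesis
  proof
    show "smooth_on (rep_dom c d \<psi>) (local_rep c d \<psi>)"
      using \<psi> c d by (auto simp: smooth_map_def)
    show "local_rep c d \<psi> x \<in> cimg d" if "x \<in> rep_dom c d \<psi>" for x
      using that homeomorphism_apply1[OF hom] by (auto simp: rep_dom_def local_rep_def cimg_def)
    show "minner (h d (local_rep c d \<psi> x)) (dif (local_rep c d \<psi>) x u) (dif (local_rep c d \<psi>) x v)
        = minner (g c x) u v" if "x \<in> rep_dom c d \<psi>" for x u v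
      using imm c d that by (auto simp: isometric_immersion_def)
  qed
qed

lemma almost_hermitian_inner_product:
  assumes "almost_hermitian_manifold A g J" "c \<in> A" "x \<in> cimg c"
  shows "hermitian_inner_product (g c x) (J c x)"
proof -
  have A: "riemannian_manifold A g"
    using assms by (simp add: almost_hermitian_manifold_def)
  interpret metric_chart "cimg c" "g c"
    using riemannian_metric_chart[OF A assms(2) open_cimg[OF A assms(2)] subset_refl] .
  show ?thesis
    using assms metric[OF assms(3)]
    by unfold_locales (auto simp: almost_hermitian_manifold_def)
qed


lemma space_form_hermitian:
  assumes "generalized_complex_space_form N h J \<alpha> \<beta>" "d \<in> N" "y \<in> cimg d"
  shows "hermitian_inner_product (h d y) (J d y)"
  using assms(1) almost_hermitian_inner_product[OF _ assms(2,3)]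
  by (simp add: generalized_complex_space_form_def)


section \<open>Hypersurfaces of constant mean curvature\<close>

lemma space_form_scalar_curvature:
  fixes N :: "('q::{t2_space, second_countable_topology}, 'n::finite) chart set"
  assumes "generalized_complex_space_form N h J \<alpha> \<beta>" "d \<in> N" "y \<in> cimg d"
  shows "scalar_curvature (h d) y =
    real CARD('n) * ((real CARD('n) - 1) * \<alpha> (cinv d y) + 3 * \<beta> (cinv d y))"
proof -
  interpret hermitian_inner_product "h d y" "J d y"
    using space_form_hermitian[OF assms] .
  let ?k = "(real CARD('n) - 1) * \<alpha> (cinv d y) + 3 * \<beta> (cinv d y)"
  have "curvature (h d) y u v w = R (\<alpha> (cinv d y)) (\<beta> (cinv d y)) u v w" for u v w
    using assms by (simp add: generalized_complex_space_form_def space_form_curvature_def)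
  then have ricci: "ricci (h d) y = (\<lambda>v w. ?k * minner (h d y) v w)"
    by (simp add: ricci_def trace_R fun_eq_iff)
  obtain E where E: "orthonormal (h d y) E" "card E = CARD('n)"
    using exists_orthonormal_basis[OF metric] by blast
  have "metric_trace (h d y) (ricci (h d) y) = (\<Sum>e\<in>E. ?k * minner (h d y) e e)"
    unfolding ricci
    by (rule metric_trace_orthonormal[OF metric E])
      (auto intro!: linearI simp: minner_bilinear algebra_simps)
  also have "\<dots> = (\<Sum>e\<in>E. ?k)"
    using E(1) by (intro sum.cong) (auto simp: orthonormal_def)
  finally show ?thesis
    by (simp add: scalar_curvature_def E(2))
qed

theorem biharmonic_hypersurface_constant_mean_curvature_harmonic:
  fixes M :: "('p::{t2_space, second_countable_topology}, 'm::finite) chart set"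
    and N :: "('q::{t2_space, second_countable_topology}, 'n::finite) chart set"
  assumes codim: "CARD('n) = Suc CARD('m)"
    and space_form: "generalized_complex_space_form N h J \<alpha> \<beta>"
    and negative: "negative_scalar_curvature N h"
    and imm: "isometric_immersion M g N h \<psi>"
    and cmc: "constant_mean_curvature M g N h \<psi>"
    and bih: "biharmonic M g N h \<psi>"
  shows "harmonic M g N h \<psi>"
  unfolding harmonic_def
proof (intro ballI)
  fix c d x
  assume c: "c \<in> M" and d: "d \<in> N" and x: "x \<in> rep_dom c d \<psi>"
  define F where "F = local_rep c d \<psi>"
  interpret isometric_immersion_chart "rep_dom c d \<psi>" "g c" "cimg d" "h d" F
    unfolding F_def using isometric_immersion_in_charts[OF imm c d] .
  let ?\<tau> = "tension (g c) (h d) F"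
  note Fx = rep_in[OF x]
  define a b where "a = \<alpha> (cinv d (F x))" and "b = \<beta> (cinv d (F x))"
  interpret hermitian_inner_product "h d (F x)" "J d (F x)"
    using space_form_hermitian[OF space_form d Fx] .
  have curv: "curvature (h d) (F x) u v w = R a b u v w" for u v w
    using space_form d Fx
    by (simp add: generalized_complex_space_form_def space_form_curvature_def a_def b_def)
  have "scalar_curvature (h d) (F x) < 0"
    using negative d Fx by (simp add: negative_scalar_curvature_def)
  then have "real CARD('n) * (real CARD('m) * a + 3 * b) < 0"
    by (simp add: space_form_scalar_curvature[OF space_form d Fx] codim a_def b_def)
  then have neg: "real CARD('m) * a + 3 * b < 0"
    by (simp add: mult_less_0_iff)
  obtain C where C: "sqrt (minner (h d (F y)) (mean_curvature_vector (g c) (h d) F y)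
      (mean_curvature_vector (g c) (h d) F y)) = C" if "y \<in> rep_dom c d \<psi>" for y
    using cmc c d unfolding constant_mean_curvature_def F_def Let_def by blast
  have norm: "minner (h d (F y)) (?\<tau> y) (?\<tau> y) = (real CARD('m) * C)\<^sup>2"
    if y: "y \<in> rep_dom c d \<psi>" for y
  proof -
    have \<tau>: "?\<tau> y = real CARD('m) *\<^sub>R mean_curvature_vector (g c) (h d) F y"
      by (simp add: mean_curvature_vector_def tension_def)
    have "minner (h d (F y)) (mean_curvature_vector (g c) (h d) F y)
        (mean_curvature_vector (g c) (h d) F y) = C\<^sup>2"
      using C[OF y] metric_matrix_nonneg[OF target.metric[OF rep_in[OF y]]]
      by (metis real_sqrt_pow2)
    then show ?thesis
      unfolding \<tau> by (simp add: minner_bilinear power2_eq_square)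
  qed
  have "bitension (g c) (h d) F x = 0"
    using bih c d x by (simp add: biharmonic_def F_def)
  then have "rough_laplacian (g c) (h d) F ?\<tau> x
      = metric_trace (g c x) (\<lambda>u v. R a b (dif F x u) (?\<tau> x) (dif F x v))"
    by (simp add: bitension_def curv)
  then have "minner (h d (F x)) (rough_laplacian (g c) (h d) F ?\<tau> x) (?\<tau> x)
      = - (real CARD('m) * a + 3 * b) * minner (h d (F x)) (?\<tau> x) (?\<tau> x)"
    using trace_R_hypersurface[OF source.metric[OF x] linear_dif_rep[OF x] isometric[OF x] codim
        tension_normal[OF x]] by simp
  then have "- (real CARD('m) * a + 3 * b) * minner (h d (F x)) (?\<tau> x) (?\<tau> x) \<le> 0"
    using rough_laplacian_constant_norm[OF smooth_tension norm x] by simp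
  then have "minner (h d (F x)) (?\<tau> x) (?\<tau> x) \<le> 0"
    using neg by (simp add: mult_le_0_iff)
  then show "tension (g c) (h d) (local_rep c d \<psi>) x = 0"
    using metric_matrix_pos[OF metric, of "?\<tau> x"] by (auto simp: F_def)
qed

theorem corollary3p7:
  fixes N :: "('q::{t2_space, second_countable_topology}, 4) chart set"
    and h :: "('q, 4) chart \<Rightarrow> 4 matrix_field"
    and J :: "('q, 4) chart \<Rightarrow> 4 matrix_field"
    and \<alpha> \<beta> :: "'q \<Rightarrow> real"
  assumes "generalized_complex_space_form N h J \<alpha> \<beta>"
    and "negative_scalar_curvature N h"
  shows "\<not> (\<exists>(M :: ('p::{t2_space, second_countable_topology}, 3) chart set)
              (g :: ('p, 3) chart \<Rightarrow> 3 matrix_field) (\<psi> :: 'p \<Rightarrow> 'q).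
            isometric_immersion M g N h \<psi> \<and>
            constant_mean_curvature M g N h \<psi> \<and>
            proper_biharmonic M g N h \<psi>)"
proof clarify
  fix M :: "('p, 3) chart set" and g :: "('p, 3) chart \<Rightarrow> 3 matrix_field" and \<psi> :: "'p \<Rightarrow> 'q"
  assume imm: "isometric_immersion M g N h \<psi>" and cmc: "constant_mean_curvature M g N h \<psi>"
    and proper: "proper_biharmonic M g N h \<psi>"
  have "CARD(4) = Suc CARD(3)" by simp
  from biharmonic_hypersurface_constant_mean_curvature_harmonic[OF this assms imm cmc]
  show False
    using proper by (simp add: proper_biharmonic_def)
qed

end
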